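(* Let $E=K(n,m,\mathcal D)$ be a Bedford-McMullen carpet of non-doubling type and assume that $a_0>a_{m-1}$. Let $0<\rho<n^{-3}$ and let $\varphi$ be a gauge function satisfying $$\lim_{k\to\infty}\frac{k}{\varphi(n^{-k})}=s\in[0,+\infty].$$ Then for every $z\in E$, $$\underline{\delta}_\varphi(z;\mu_E,\rho)=\begin{cases} s\,(1/\sigma-1)\log(a_0/a_{m-1}), & \text{if } z\in V_E,\\ 0, & \text{otherwise.}\end{cases}$$
   Context: Let $n>m\ge 2$ be integers, $\sigma=\log m/\log n$, and let $\mathcal D\subset\{0,\dots,n-1\}\times\{0,\dots,m-1\}$ be nonempty. For $\mathbf d\in\mathcal D$ let $S_{\mathbf d}(z)=\mathrm{diag}(n^{-1},m^{-1})(z+\mathbf d)$ on $\mathbb R^2$, and $S_{\mathbf d_1\dots\mathbf d_k}=S_{\mathbf d_1}\circ\cdots\circ S_{\mathbf d_k}$. The Bedford-McMullen carpet $E=K(n,m,\mathcal D)$ is the unique nonempty compact set with $E=\bigcup_{\mathbf d\in\mathcal D}S_{\mathbf d}(E)$, a metric space with the Euclidean distance. Its uniform Bernoulli measure $\mu_E$ is the unique Borel probability measure supported on $E$ with $\mu_E=\frac1{\#\mathcal D}\sum_{\mathbf d\in\mathcal D}\mu_E\circ S_{\mathbf d}^{-1}$. The fiber sequence is $a_j=\#\{i:(i,j)\in\mathcal D\}$, $0\le j\le m-1$. $B_r(x)$ denotes the open ball. A Borel probability measure $\mu$ is doubling if $\sup_{x\in\mathrm{supp}\,\mu,\ r>0}\mu(B_{2r}(x))/\mu(B_r(x))<\infty$.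 $E$ is of non-doubling type if $\mu_E$ is not doubling. (Known, due to Li-Wei-Wen: this holds if and only if $a_0a_{m-1}>0$, $a_0\ne a_{m-1}$, and $a_ja_{j+1}>0$ for some $0\le j\le m-2$.) A gauge function is a strictly decreasing $\varphi:(0,1)\to\mathbb R^+$ with $\lim_{r\to0}\varphi(r)=\infty$. For a measure $\mu$ on a metric space $X$ (here $X=E$), $0<\rho<1$ and $z\in X$, the lower doubling index is $$\underline\delta_\varphi(z;\mu,\rho)=\liminf_{r\to0}\ \sup_{z'\in X:\ B_{\rho r}(z')\subset B_r(z)}\frac{\log[\mu(B_r(z))/\mu(B_{\rho r}(z'))]}{\varphi(r)}.$$ A coding of $z\in E$ is a sequence $(\mathbf d_j)_{j\ge1}\in\mathcal D^\infty$ with $\{z\}=\bigcap_{k\ge1}S_{\mathbf d_1\dots\mathbf d_k}([0,1]^2)$; writing $\mathbf d_j=(x_j,y_j)$, the coding is also written $(\mathbf x,\mathbf y)=((x_j)_j,(y_j)_j)$. $V_E$ is the set of $z\in E$ having two codings $(\mathbf x,\mathbf y)$, $(\mathbf x',\mathbf y')$ with $\mathbf y\ne\mathbf y'$. *)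

theory Defs
  imports "HOL-Probability.Probability"
begin

text \<open>The plane is \<^typ>\<open>real \<times> real\<close>, whose \<^const>\<open>dist\<close> is the Euclidean distance.\<close>

definition bm_map :: "nat \<Rightarrow> nat \<Rightarrow> nat \<times> nat \<Rightarrow> real \<times> real \<Rightarrow> real \<times> real" where
  "bm_map n m d z = ((fst z + real (fst d)) / real n, (snd z + real (snd d)) / real m)"

definition bm_digits :: "nat \<Rightarrow> nat \<Rightarrow> (nat \<times> nat) set \<Rightarrow> bool" where
  "bm_digits n m D \<longleftrightarrow> n > m \<and> m \<ge> 2 \<and> D \<noteq> {} \<and> D \<subseteq> {0..<n} \<times> {0..<m}"

text \<open>\<open>E = K(n, m, D)\<close>. By Hutchinson's theorem exactly one set \<open>E\<close> satisfies this
  when \<open>bm_digits n m D\<close> holds.\<close>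
definition is_bm_carpet :: "nat \<Rightarrow> nat \<Rightarrow> (nat \<times> nat) set \<Rightarrow> (real \<times> real) set \<Rightarrow> bool" where
  "is_bm_carpet n m D E \<longleftrightarrow> E \<noteq> {} \<and> compact E \<and> E = (\<Union>d\<in>D. bm_map n m d ` E)"

text \<open>The uniform Bernoulli measure of the carpet \<open>E\<close> (again unique), regarded as a Borel measure
  on the plane that is concentrated on \<open>E\<close>.\<close>
definition is_uniform_bernoulli ::
    "nat \<Rightarrow> nat \<Rightarrow> (nat \<times> nat) set \<Rightarrow> (real \<times> real) set \<Rightarrow> (real \<times> real) measure \<Rightarrow> bool" where
  "is_uniform_bernoulli n m D E \<mu> \<longleftrightarrow>
     prob_space \<mu> \<and> sets \<mu> = sets borel \<and> (AE z in \<mu>. z \<in> E) \<and>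
     (\<forall>A\<in>sets borel. measure \<mu> A =
        1 / real (card D) * (\<Sum>d\<in>D. measure (distr \<mu> borel (bm_map n m d)) A))"

definition fiber :: "(nat \<times> nat) set \<Rightarrow> nat \<Rightarrow> nat" where
  "fiber D j = card {i. (i, j) \<in> D}"

definition measure_support :: "'a::metric_space measure \<Rightarrow> 'a set" where
  "measure_support \<mu> = {x. \<forall>r>0. emeasure \<mu> (ball x r) > 0}"

definition doubling :: "'a::metric_space measure \<Rightarrow> bool" where
  "doubling \<mu> \<longleftrightarrow>
     (SUP x\<in>measure_support \<mu>. SUP r\<in>{0<..}. emeasure \<mu> (ball x (2 * r)) / emeasure \<mu> (ball x r)) < \<infinity>"

text \<open>Values outside the interval \<open>(0, 1)\<close> are irrelevant.\<close>
definition gauge_function :: "(real \<Rightarrow> real) \<Rightarrow> bool" where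
  "gauge_function \<phi> \<longleftrightarrow>
     (\<forall>r\<in>{0<..<1}. \<phi> r > 0) \<and> strict_antimono_on {0<..<1} \<phi> \<and> filterlim \<phi> at_top (at_right 0)"

text \<open>The metric space is the subset \<open>X\<close> of the ambient type, so its open balls are the traces
  \<open>ball z r \<inter> X\<close>.\<close>
definition lower_doubling_index ::
    "'a::metric_space set \<Rightarrow> (real \<Rightarrow> real) \<Rightarrow> 'a \<Rightarrow> 'a measure \<Rightarrow> real \<Rightarrow> ereal" where
  "lower_doubling_index X \<phi> z \<mu> \<rho> =
     Liminf (at_right 0) (\<lambda>r.
       SUP z'\<in>{z'\<in>X. ball z' (\<rho> * r) \<inter> X \<subseteq> ball z r \<inter> X}.
         ereal (ln (measure \<mu> (ball z r \<inter> X) / measure \<mu> (ball z' (\<rho> * r) \<inter> X)) / \<phi> r))"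

text \<open>Digit sequences are indexed from \<open>0\<close>: \<open>bm_word n m d k\<close> is the composition of the maps of
  \<open>d 0, \<dots>, d (k - 1)\<close>, the map of \<open>d 0\<close> being outermost.\<close>
primrec bm_word :: "nat \<Rightarrow> nat \<Rightarrow> (nat \<Rightarrow> nat \<times> nat) \<Rightarrow> nat \<Rightarrow> real \<times> real \<Rightarrow> real \<times> real" where
  "bm_word n m d 0 = id"
| "bm_word n m d (Suc k) = bm_word n m d k \<circ> bm_map n m (d k)"

definition is_coding ::
    "nat \<Rightarrow> nat \<Rightarrow> (nat \<times> nat) set \<Rightarrow> (nat \<Rightarrow> nat \<times> nat) \<Rightarrow> real \<times> real \<Rightarrow> bool" where
  "is_coding n m D d z \<longleftrightarrow>
     (\<forall>j. d j \<in> D) \<and> {z} = (\<Inter>k\<in>{1..}. bm_word n m d k ` ({0..1} \<times> {0..1}))"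

definition vertical_overlap ::
    "nat \<Rightarrow> nat \<Rightarrow> (nat \<times> nat) set \<Rightarrow> (real \<times> real) set \<Rightarrow> (real \<times> real) set" where
  "vertical_overlap n m D E =
     {z\<in>E. \<exists>d d'. is_coding n m D d z \<and> is_coding n m D d' z \<and> snd \<circ> d \<noteq> snd \<circ> d'}"

end

theory Submission imports Defs begin

text \<open>A word of \<open>t\<close> digits is located in the grid with \<open>n ^ k\<close> columns and \<open>m ^ t\<close> rows, where
  \<open>1 / n ^ k\<close> and \<open>1 / m ^ t\<close> are both comparable to \<open>r\<close>; a ball of radius \<open>r\<close> meets boundedly many cells
  of this grid. A cell with row digits \<open>V\<close> has mass \<open>1 / (card D) ^ t\<close> times the product of the fibers
  \<open>fiber D (V ! j)\<close> over \<open>k \<le> j < t\<close>.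

  At a point of the overlap set, the rows just above and below the point end in \<open>0, 0, \<dots>\<close> and in
  \<open>m - 1, m - 1, \<dots>\<close>. Hence the ball around the point has mass about \<open>(fiber D 0) ^ (t - k)\<close>, while
  small balls strictly below it have mass about \<open>(fiber D (m - 1)) ^ (t - k)\<close>, in the same units. At any other
  point there are arbitrarily small radii for which all words meeting the ball have the same row
  digits, and then all masses in question are comparable.\<close>

text \<open>At an overlap point only the exponent \<open>t - k\<close> matters. It equals
  \<open>(1 / ln m - 1 / ln n) * ln (1 / r)\<close> up to a bounded error, so the logarithm of the
  extremal mass ratio is this number times \<open>ln (fiber D 0 / fiber D (m - 1))\<close>, again up
  to a bounded error. The gauge tends to infinity, so bounded errors vanish after division by
  \<open>\<phi> r\<close>; hence every mass estimate is needed only up to a constant factor. Since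
  \<open>ln (1 / r) / \<phi> r\<close> tends to \<open>s * ln n\<close>, and
  \<open>ln n * (1 / ln m - 1 / ln n) = 1 / \<sigma> - 1\<close>, the claimed value results. The two
  cases are treated asymmetrically because the index is a lower limit: at an overlap point the
  estimates must hold at every small radius, while elsewhere good radii arbitrarily close to zero
  suffice. Column neighbours are harmless, because cells with equal row digits have equal
  mass.\<close>

section \<open>Positional expansions and the level belonging to a radius\<close>

primrec digit_value :: "nat \<Rightarrow> nat list \<Rightarrow> nat" where
  "digit_value b [] = 0"
| "digit_value b (x # xs) = x * b ^ length xs + digit_value b xs"

lemma digit_value_append: "digit_value b (xs @ ys) = digit_value b xs * b ^ length ys + digit_value b ys"
  by (induction xs) (auto simp: power_add algebra_simps)

lemma digit_value_less: "\<forall>x\<in>set xs. x < b \<Longrightarrow> digit_value b xs < b ^ length xs"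
proof (induction xs)
  case (Cons x xs)
  then have "digit_value b xs < b ^ length xs" "Suc x \<le> b" by auto
  then have "x * b ^ length xs + digit_value b xs < Suc x * b ^ length xs" by simp
  also have "\<dots> \<le> b * b ^ length xs" using \<open>Suc x \<le> b\<close> by (rule mult_le_mono1)
  finally show ?case by simp
qed simp

lemma digit_value_inj:
  assumes "length xs = length ys" "\<forall>x\<in>set xs. x < b" "\<forall>y\<in>set ys. y < b" "digit_value b xs = digit_value b ys"
  shows "xs = ys"
  using assms
proof (induction xs ys rule: list_induct2)
  case (Cons x xs y ys)
  have l: "digit_value b xs < b ^ length xs" "digit_value b ys < b ^ length xs"
    using Cons digit_value_less[of xs b] digit_value_less[of ys b] by auto
  have e: "b ^ length xs * x + digit_value b xs = b ^ length xs * y + digit_value b ys"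
    using Cons by (simp add: mult.commute)
  have b: "b ^ length xs \<noteq> 0" using l by linarith
  have "x = (b ^ length xs * x + digit_value b xs) div b ^ length xs" using l b by (subst div_mult_self4) auto
  also have "\<dots> = y" unfolding e using l b by (subst div_mult_self4) auto
  finally show ?case using e Cons by auto
qed simp

text \<open>\<open>k\<close> is the predecessor of the least exponent whose power exceeds
  \<open>1 / r\<close>; that exponent is positive because \<open>r \<le> 1\<close>. The first two
  facts compare cell sizes with \<open>r\<close>, the logarithmic ones convert levels into multiples
  of \<open>ln (1 / r)\<close>.\<close>

lemma ex_scale:
  fixes r :: real
  assumes "2 \<le> b" "0 < r" "r \<le> 1"
  obtains k :: nat where "r \<le> 1 / real b ^ k" "1 / real b ^ Suc k < r"
    "real k * ln (real b) \<le> ln (1 / r)" "ln (1 / r) \<le> (real k + 1) * ln (real b)"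
proof -
  have "\<exists>k. 1 / r < real b ^ k"
    using assms by (intro real_arch_pow) auto
  define k' where "k' = (LEAST k. 1 / r < real b ^ k)"
  have k': "1 / r < real b ^ k'"
    unfolding k'_def using \<open>\<exists>k. _\<close> by (rule LeastI_ex)
  have "k' \<noteq> 0"
  proof
    assume "k' = 0"
    with k' assms show False by (simp add: field_simps)
  qed
  then obtain k where k: "k' = Suc k" using not0_implies_Suc by blast
  have "\<not> 1 / r < real b ^ k"
    using not_less_Least[of k "\<lambda>k. 1 / r < real b ^ k"] k unfolding k'_def by simp
  then have k1: "real b ^ k \<le> 1 / r" by simp
  have k2: "1 / r < real b ^ Suc k" using k' k by simp
  have b: "real b > 0" using assms by simp
  have bk: "real b ^ i > 0" for i using b by simp
  show thesis
  proof
    show "r \<le> 1 / real b ^ k" using k1 assms bk[of k] by (simp add: field_simps)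
    show "1 / real b ^ Suc k < r" using k2 assms bk[of "Suc k"] by (simp add: field_simps)
    have "ln (real b ^ k) \<le> ln (1 / r)" using k1 assms bk[of k] by (subst ln_le_cancel_iff) auto
    then show "real k * ln (real b) \<le> ln (1 / r)" by (simp add: ln_realpow)
    have "ln (1 / r) \<le> ln (real b ^ Suc k)" 
      using k2 assms bk[of "Suc k"] by (subst ln_le_cancel_iff) auto
    also have "\<dots> = (real k + 1) * ln (real b)" using ln_realpow[of "real b" "Suc k"] by (simp add: algebra_simps)
    finally show "ln (1 / r) \<le> (real k + 1) * ln (real b)" .
  qed
qed

lemma abs_diff_scale:
  fixes a b c :: real
  assumes "0 < c"
  shows "\<bar>a - b\<bar> < r / c \<longleftrightarrow> \<bar>c * a - c * b\<bar> < r" "\<bar>a - b\<bar> \<le> r / c \<longleftrightarrow> \<bar>c * a - c * b\<bar> \<le> r"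
proof -
  have "\<bar>c * a - c * b\<bar> = c * \<bar>a - b\<bar>"
    using assms by (simp add: right_diff_distrib[symmetric] abs_mult)
  then show "\<bar>a - b\<bar> < r / c \<longleftrightarrow> \<bar>c * a - c * b\<bar> < r" "\<bar>a - b\<bar> \<le> r / c \<longleftrightarrow> \<bar>c * a - c * b\<bar> \<le> r"
    using assms by (simp_all add: field_simps)
qed

section \<open>Words and the self-similar measure\<close>

locale bm_carpet =
  fixes n m :: nat and D :: "(nat \<times> nat) set"
    and E :: "(real \<times> real) set" and \<mu> :: "(real \<times> real) measure"
  assumes digits: "bm_digits n m D"
    and carpet: "is_bm_carpet n m D E"
    and bernoulli: "is_uniform_bernoulli n m D E \<mu>"
begin

sublocale prob_space \<mu>
  using bernoulli by (simp add: is_uniform_bernoulli_def)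

lemma sets_mu [measurable_cong, simp]: "sets \<mu> = sets borel"
  using bernoulli by (simp add: is_uniform_bernoulli_def)

lemma space_mu [simp]: "space \<mu> = UNIV"
  using sets_eq_imp_space_eq[OF sets_mu] by simp

lemma nm: "m < n" "2 \<le> m" "0 < m" "0 < n" "2 \<le> n" "3 \<le> n"
  using digits by (auto simp: bm_digits_def)

lemma D_less: "d \<in> D \<Longrightarrow> fst d < n" "d \<in> D \<Longrightarrow> snd d < m"
  using digits by (auto simp: bm_digits_def)

lemma finite_D [simp]: "finite D"
  using digits finite_subset[of D "{0..<n} \<times> {0..<m}"] by (auto simp: bm_digits_def)

lemma card_D_pos: "0 < card D"
  using digits by (auto simp: bm_digits_def card_gt_0_iff)

text \<open>Both coordinates follow from one extremum argument. Where a coordinate \<open>f\<close>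
  is maximal on \<open>E\<close>, self-similarity gives \<open>b * f u \<le> f u + (b - 1)\<close>,
  hence \<open>f u \<le> 1\<close>; a minimum point gives \<open>f l \<le> b * f l\<close>, hence
  \<open>f l \<ge> 0\<close>.\<close>

lemma E_unit: "z \<in> E \<Longrightarrow> fst z \<in> {0..1} \<and> snd z \<in> {0..1}"
  and E_ne: "E \<noteq> {}" and compact_E: "compact E" and E_eq: "E = (\<Union>d\<in>D. bm_map n m d ` E)"
proof -
  show ne: "E \<noteq> {}" and cp: "compact E" and eq: "E = (\<Union>d\<in>D. bm_map n m d ` E)"
    using carpet unfolding is_bm_carpet_def by blast+
  have aux: "\<forall>z\<in>E. f z \<in> {0..1}"
    if cf: "continuous_on E f" and that: "1 < b" "\<And>z d. d \<in> D \<Longrightarrow> f (bm_map n m d z) = (f z + real (g d)) / real b"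
      "\<And>d. d \<in> D \<Longrightarrow> g d < b" for f :: "real \<times> real \<Rightarrow> real" and g and b :: nat
  proof -
    obtain u where u: "u \<in> E" "\<forall>z\<in>E. f z \<le> f u"
      using continuous_attains_sup[OF cp ne, of f] cf by blast
    obtain l where l: "l \<in> E" "\<forall>z\<in>E. f l \<le> f z"
      using continuous_attains_inf[OF cp ne, of f] cf by blast
    obtain d u' where d: "d \<in> D" "u' \<in> E" "u = bm_map n m d u'" using u(1) eq by blast
    have "f u * b = f u' + real (g d)" using that(1) that(2)[OF d(1), of u'] d(3) by simp
    also have "\<dots> \<le> f u + (real b - 1)" using u d(2) that(3)[OF d(1)] by (intro add_mono) auto
    finally have "(f u - 1) * (real b - 1) \<le> 0" by (simp add: algebra_simps)
    then have 1: "f u \<le> 1" using that(1) by (simp add: mult_le_0_iff)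
    obtain d l' where d: "d \<in> D" "l' \<in> E" "l = bm_map n m d l'" using l(1) eq by blast
    have "f l \<le> f l' + real (g d)" using l d by (intro add_increasing2) auto
    also have "\<dots> = f l * b" using that(1) that(2)[OF d(1), of l'] d(3) by simp
    finally have "f l * (real b - 1) \<ge> 0" by (simp add: algebra_simps)
    then have "f l \<ge> 0" using that(1) by (simp add: zero_le_mult_iff)
    with 1 show ?thesis using u l by force
  qed
  have "\<forall>z\<in>E. fst z \<in> {0..1}"
    by (rule aux[of fst n fst]) (use nm D_less in \<open>auto simp: bm_map_def intro: continuous_intros\<close>)
  moreover have "\<forall>z\<in>E. snd z \<in> {0..1}"
    by (rule aux[of snd m snd]) (use nm D_less in \<open>auto simp: bm_map_def intro: continuous_intros\<close>)
  ultimately show "z \<in> E \<Longrightarrow> fst z \<in> {0..1} \<and> snd z \<in> {0..1}" by blast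
qed

text \<open>The composition of the digit maps in closed form, which exposes the column and row index
  of a cell as integers written in base \<open>n\<close> and base \<open>m\<close>, the outermost
  digit leading.\<close>

definition word_map :: "(nat \<times> nat) list \<Rightarrow> real \<times> real \<Rightarrow> real \<times> real" where
  "word_map w z = ((real (digit_value n (map fst w)) + fst z) / real n ^ length w,
             (real (digit_value m (map snd w)) + snd z) / real m ^ length w)"

definition words :: "nat \<Rightarrow> (nat \<times> nat) list set" where
  "words k = {w. set w \<subseteq> D \<and> length w = k}"

lemma finite_words [simp]: "finite (words k)"
  unfolding words_def by (rule finite_lists_length_eq) simp

lemma words_append: "u \<in> words k \<Longrightarrow> v \<in> words l \<Longrightarrow> u @ v \<in> words (k + l)"
  and words_take: "w \<in> words l \<Longrightarrow> k \<le> l \<Longrightarrow> take k w \<in> words k"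
  and words_drop: "w \<in> words l \<Longrightarrow> drop k w \<in> words (l - k)"
  and words_length: "w \<in> words l \<Longrightarrow> length w = l"
  unfolding words_def by (auto dest: in_set_takeD in_set_dropD)

lemma words_digits: "w \<in> words l \<Longrightarrow> \<forall>x\<in>set (map fst w). x < n"
  "w \<in> words l \<Longrightarrow> \<forall>x\<in>set (map snd w). x < m"
  using D_less by (auto simp: words_def)

lemma word_map_Nil [simp]: "word_map [] = id"
  by (auto simp: word_map_def)

lemma word_map_Cons: "word_map (d # w) = bm_map n m d \<circ> word_map w"
proof
  fix z
  have *: "(real (d * b ^ l + j) + e) / real b ^ Suc l = ((real j + e) / real b ^ l + real d) / real b"
    if "b \<noteq> 0" for b d l j :: nat and e :: real
  proof -
    have "(real j + e) / real b ^ l + real d = (real (d * b ^ l + j) + e) / real b ^ l"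
      using that by (simp add: add_divide_distrib)
    then show ?thesis by (simp add: mult.commute)
  qed
  show "word_map (d # w) z = (bm_map n m d \<circ> word_map w) z"
    using nm *[of n] *[of m] by (simp add: word_map_def bm_map_def)
qed

lemma word_map_append: "word_map (u @ v) = word_map u \<circ> word_map v"
  by (induction u) (auto simp: word_map_Cons)

lemma bm_word_eq: "bm_word n m d k = word_map (map d [0..<k])"
  by (induction k) (auto simp: word_map_append word_map_Cons)

lemma word_map_E_subset: "w \<in> words k \<Longrightarrow> word_map w ` E \<subseteq> E"
proof (induction w arbitrary: k)
  case (Cons d w)
  then have "word_map w ` E \<subseteq> E" "d \<in> D" by (auto simp: words_def)
  then show ?case using E_eq unfolding word_map_Cons by fastforce
qed simp

lemma E_word: "z \<in> E \<Longrightarrow> \<exists>w\<in>words k. z \<in> word_map w ` E"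
proof (induction k arbitrary: z)
  case 0
  then show ?case by (intro bexI[of _ "[]"]) (auto simp: words_def)
next
  case (Suc k)
  obtain d z' where "d \<in> D" "z' \<in> E" "z = bm_map n m d z'" using Suc.prems E_eq by blast
  moreover from Suc.IH[OF this(2)] obtain w where "w \<in> words k" "z' \<in> word_map w ` E" by blast
  ultimately show ?case by (intro bexI[of _ "d # w"]) (auto simp: words_def word_map_Cons)
qed

lemma bm_map_measurable [measurable]: "bm_map n m d \<in> borel_measurable borel"
  unfolding bm_map_def by (intro borel_measurable_continuous_onI continuous_intros)
     (use nm in auto)

lemma continuous_word_map: "continuous_on S (word_map w)"
  unfolding word_map_def by (intro continuous_intros) (use nm in auto)

lemma word_map_measurable [measurable]: "word_map w \<in> borel_measurable borel"
  by (intro borel_measurable_continuous_onI continuous_word_map)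

lemma compact_word_map_E: "compact (word_map w ` E)"
  by (intro compact_continuous_image continuous_word_map compact_E)

lemma words_Suc: "words (Suc k) = (\<lambda>(d, w). d # w) ` (D \<times> words k)"
  by (auto simp: words_def length_Suc_conv image_iff)

text \<open>Pulling a set back through words, rather than measuring cylinders, makes overlaps of
  adjacent cylinders along their edges irrelevant: no statement about null sets is needed.\<close>

lemma measure_iterate:
  assumes "A \<in> sets borel"
  shows "measure \<mu> A = (\<Sum>w\<in>words k. measure \<mu> (word_map w -` A)) / real (card D) ^ k"
  using assms
proof (induction k arbitrary: A)
  case 0
  have "words 0 = {[]}" by (auto simp: words_def)
  then show ?case by simp
next
  case (Suc k)
  have [measurable]: "bm_map n m d -` A \<in> sets borel" for d
    using measurable_sets[OF bm_map_measurable Suc.prems] by simp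
  have "measure \<mu> A = 1 / real (card D) * (\<Sum>d\<in>D. measure (distr \<mu> borel (bm_map n m d)) A)"
    using bernoulli Suc.prems by (simp add: is_uniform_bernoulli_def)
  also have "\<dots> = 1 / real (card D) * (\<Sum>d\<in>D. measure \<mu> (bm_map n m d -` A))"
    using Suc.prems by (simp add: measure_distr)
  also have "\<dots> = (\<Sum>d\<in>D. \<Sum>w\<in>words k. measure \<mu> (word_map (d # w) -` A)) / real (card D) ^ Suc k"
    by (simp add: Suc.IH sum_divide_distrib word_map_Cons vimage_comp field_simps)
  also have "(\<Sum>d\<in>D. \<Sum>w\<in>words k. measure \<mu> (word_map (d # w) -` A)) =
      (\<Sum>w\<in>words (Suc k). measure \<mu> (word_map w -` A))"
    unfolding words_Suc
    by (subst sum.reindex) (auto simp: inj_on_def sum.cartesian_product split_def)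
  finally show ?case .
qed

lemma AE_E: "AE z in \<mu>. z \<in> E"
  using bernoulli by (simp add: is_uniform_bernoulli_def)

lemma E_sets [measurable]: "E \<in> sets borel"
  using compact_E by (simp add: borel_compact)

lemma vimage_sets: "A \<in> sets borel \<Longrightarrow> word_map w -` A \<in> sets borel"
  using measurable_sets[OF word_map_measurable] by simp

text \<open>In \<open>measure_iterate\<close> every summand is at most 1, and a word whose image of
  \<open>E\<close> misses \<open>A\<close> contributes 0, because the measure is concentrated on
  \<open>E\<close>. The mass is therefore bounded by a count of words.\<close>

lemma measure_le:
  assumes A: "A \<in> sets borel" and F: "finite F" "\<And>w. w \<in> words t \<Longrightarrow> word_map w ` E \<inter> A \<noteq> {} \<Longrightarrow> w \<in> F"
  shows "measure \<mu> A \<le> real (card F) / real (card D) ^ t"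
proof -
  have "measure \<mu> (word_map w -` A) \<le> (if w \<in> F then 1 else 0)" if "w \<in> words t" for w
  proof (cases "w \<in> F")
    case False
    then have "word_map w ` E \<inter> A = {}" using F that by blast
    then have "AE z in \<mu>. z \<notin> word_map w -` A" using AE_E by (auto elim!: eventually_mono)
    then have "measure \<mu> (word_map w -` A) = 0"
      using vimage_sets[OF A] by (subst prob_eq_0) auto
    then show ?thesis using False by simp
  qed simp
  then have "(\<Sum>w\<in>words t. measure \<mu> (word_map w -` A)) \<le> (\<Sum>w\<in>words t. if w \<in> F then 1 else 0)"
    by (rule sum_mono)
  also have "\<dots> = real (card (words t \<inter> F))" by (simp add: sum.If_cases)
  also have "\<dots> \<le> real (card F)" using F(1) by (intro of_nat_mono card_mono) auto
  finally show ?thesis unfolding measure_iterate[OF A, of t] by (intro divide_right_mono) auto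
qed

lemma measure_ge:
  assumes A: "A \<in> sets borel" and F: "F \<subseteq> words t" "\<And>w. w \<in> F \<Longrightarrow> word_map w ` E \<subseteq> A"
  shows "real (card F) / real (card D) ^ t \<le> measure \<mu> A"
proof -
  have "real (card F) = (\<Sum>w\<in>F. measure \<mu> (word_map w -` A))"
  proof -
    have "measure \<mu> (word_map w -` A) = 1" if "w \<in> F" for w
    proof -
      have "AE z in \<mu>. z \<in> word_map w -` A" using AE_E F(2)[OF that] by (auto elim!: eventually_mono)
      then show ?thesis using vimage_sets[OF A] by (subst prob_eq_1) auto
    qed
    then show ?thesis by simp
  qed
  also have "\<dots> \<le> (\<Sum>w\<in>words t. measure \<mu> (word_map w -` A))"
    using F by (intro sum_mono2) auto
  finally show ?thesis unfolding measure_iterate[OF A, of t] by (intro divide_right_mono) auto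
qed

section \<open>Measures of balls\<close>

text \<open>The number of words over \<open>D\<close> with the prescribed row digits, by
  \<open>card_snd_eq\<close>: each row digit leaves \<open>fiber D\<close> choices of a
  column.\<close>

definition row_weight :: "nat list \<Rightarrow> nat" where
  "row_weight V = prod_list (map (fiber D) V)"

lemma row_weight_append: "row_weight (U @ V) = row_weight U * row_weight V"
  by (simp add: row_weight_def)

lemma finite_row [simp]: "finite {i. (i, j) \<in> D}"
proof -
  have "{i. (i, j) \<in> D} \<subseteq> fst ` D" by force
  then show ?thesis using finite_D finite_subset by blast
qed

lemma fiber_le: "fiber D j \<le> card D"
proof -
  have "fiber D j = card ((\<lambda>i. (i, j)) ` {i. (i, j) \<in> D})"
    unfolding fiber_def by (subst card_image) (auto simp: inj_on_def)
  also have "\<dots> \<le> card D" by (intro card_mono) auto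
  finally show ?thesis .
qed

lemma fiber_ge_1: "d \<in> D \<Longrightarrow> 1 \<le> fiber D (snd d)"
proof -
  assume "d \<in> D"
  then have "fst d \<in> {i. (i, snd d) \<in> D}" by simp
  then have "0 < fiber D (snd d)" unfolding fiber_def by (subst card_gt_0_iff) (use finite_row in blast)
  then show ?thesis by simp
qed

lemma row_weight_le: "row_weight V \<le> card D ^ length V"
  by (induction V) (auto simp: row_weight_def intro: mult_le_mono fiber_le)

lemma row_weight_ge_1: "set w \<subseteq> D \<Longrightarrow> 1 \<le> row_weight (map snd w)"
proof (induction w)
  case (Cons d w)
  then show ?case using mult_le_mono[OF fiber_ge_1[of d], of 1 "row_weight (map snd w)"] by (auto simp: row_weight_def)
qed (simp add: row_weight_def)

lemma row_weight_replicate: "row_weight (replicate l j) = fiber D j ^ l"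
  by (induction l) (auto simp: row_weight_def)

lemma finite_snd_eq: "finite {v. set v \<subseteq> D \<and> map snd v = V}"
  by (rule finite_subset[OF _ finite_words[of "length V"]]) (auto simp: words_def dest: arg_cong[of _ _ length])

lemma card_snd_eq: "card {v. set v \<subseteq> D \<and> map snd v = V} = row_weight V"
proof (induction V)
  case Nil
  have "{v. set v \<subseteq> D \<and> map snd v = []} = {[]}" by auto
  then show ?case by (simp add: row_weight_def)
next
  case (Cons j V)
  have "{v. set v \<subseteq> D \<and> map snd v = j # V} =
      (\<lambda>(i, v). (i, j) # v) ` ({i. (i, j) \<in> D} \<times> {v. set v \<subseteq> D \<and> map snd v = V})"
    by (auto simp: image_iff map_eq_Cons_conv)
  then have "card {v. set v \<subseteq> D \<and> map snd v = j # V} =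
      card ({i. (i, j) \<in> D} \<times> {v. set v \<subseteq> D \<and> map snd v = V})"
    by (simp add: card_image inj_on_def)
  then show ?case using Cons by (simp add: card_cartesian_product fiber_def row_weight_def)
qed

text \<open>A word with given rows is determined by the column index of its first \<open>k\<close>
  digits, which lies in \<open>B\<close>, and by its remaining digits, for which the rows leave
  \<open>row_weight (drop k V)\<close> choices.\<close>

lemma measure_le_row_weight:
  assumes A: "A \<in> sets borel" and "k \<le> t" "finite \<V>" "finite B"
    and hit: "\<And>w. w \<in> words t \<Longrightarrow> word_map w ` E \<inter> A \<noteq> {} \<Longrightarrow>
      map snd w \<in> \<V> \<and> digit_value n (map fst (take k w)) \<in> B"
  shows "measure \<mu> A \<le> real (card B) * (\<Sum>V\<in>\<V>. real (row_weight (drop k V))) / real (card D) ^ t"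
proof -
  define F where "F V = {w\<in>words t. map snd w = V \<and> digit_value n (map fst (take k w)) \<in> B}" for V
  have fin: "finite (F V)" for V unfolding F_def by simp
  have "card (F V) \<le> card B * row_weight (drop k V)" for V
  proof -
    define f where "f w = (digit_value n (map fst (take k w)), drop k w)" for w :: "(nat \<times> nat) list"
    have "inj_on f (F V)"
    proof (rule inj_onI)
      fix u w assume u: "u \<in> F V" and w: "w \<in> F V" and e: "f u = f w"
      have tk: "take k u \<in> words k" "take k w \<in> words k"
        using u w assms(2) by (auto simp: F_def intro: words_take)
      have "map fst (take k u) = map fst (take k w)"
        using e words_digits(1)[OF tk(1)] words_digits(1)[OF tk(2)] words_length[OF tk(1)] words_length[OF tk(2)]
        by (intro digit_value_inj[of _ _ n]) (auto simp: f_def)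
      moreover have "map snd (take k u) = map snd (take k w)"
        using u w by (simp add: F_def take_map[symmetric])
      ultimately have "take k u = take k w"
        by (metis zip_map_fst_snd)
      then show "u = w" using e by (metis append_take_drop_id f_def prod.inject)
    qed
    moreover have "f ` F V \<subseteq> B \<times> {v. set v \<subseteq> D \<and> map snd v = drop k V}"
      by (auto simp: f_def F_def drop_map words_def dest: in_set_dropD)
    ultimately have "card (F V) \<le> card (B \<times> {v. set v \<subseteq> D \<and> map snd v = drop k V})"
      using assms(4) finite_snd_eq by (intro card_inj_on_le[of f]) auto
    then show ?thesis by (simp add: card_cartesian_product card_snd_eq)
  qed
  then have "card (\<Union>V\<in>\<V>. F V) \<le> (\<Sum>V\<in>\<V>. card B * row_weight (drop k V))"
    using card_UN_le[OF assms(3), of F] sum_mono[of \<V> "\<lambda>V. card (F V)"] by (meson order_trans)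
  then have "card (\<Union>V\<in>\<V>. F V) \<le> card B * (\<Sum>V\<in>\<V>. row_weight (drop k V))"
    by (simp add: sum_distrib_left)
  then have "real (card (\<Union>V\<in>\<V>. F V)) \<le> real (card B * (\<Sum>V\<in>\<V>. row_weight (drop k V)))"
    by (rule of_nat_mono)
  moreover have "measure \<mu> A \<le> real (card (\<Union>V\<in>\<V>. F V)) / real (card D) ^ t"
    using assms(3) fin hit by (intro measure_le[OF A]) (auto simp: F_def)
  ultimately show ?thesis
    by (elim order_trans) (intro divide_right_mono, auto)
qed

text \<open>Freezing the first \<open>k\<close> digits of \<open>w\<close> and varying the later
  columns within their rows produces exactly \<open>row_weight (drop k (map snd w))\<close> words of
  full contribution.\<close>

lemma measure_ge_row_weight:
  assumes A: "A \<in> sets borel" and w: "w \<in> words t"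
    and sub: "\<And>w'. w' \<in> words t \<Longrightarrow> map snd w' = map snd w \<Longrightarrow> take k w' = take k w \<Longrightarrow> word_map w' ` E \<subseteq> A"
  shows "real (row_weight (drop k (map snd w))) / real (card D) ^ t \<le> measure \<mu> A"
proof -
  let ?G = "{v. set v \<subseteq> D \<and> map snd v = drop k (map snd w)}"
  let ?F = "(\<lambda>v. take k w @ v) ` ?G"
  have *: "map snd (take k w @ v) = map snd w \<and> take k (take k w @ v) = take k w \<and> take k w @ v \<in> words t"
    if "v \<in> ?G" for v
  proof -
    have "length v = length w - k" using that by (auto dest: arg_cong[of _ _ length])
    then show ?thesis using that w
      by (auto simp: words_def drop_map take_map min_def dest: in_set_takeD)
        (metis append_take_drop_id map_append take_map)+
  qed
  have "card ?F = row_weight (drop k (map snd w))"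
    by (subst card_image) (auto simp: inj_on_def card_snd_eq)
  moreover have "real (card ?F) / real (card D) ^ t \<le> measure \<mu> A"
    using * by (intro measure_ge[OF A] sub) auto
  ultimately show ?thesis by simp
qed

definition hits :: "nat \<Rightarrow> (real \<times> real) set \<Rightarrow> (nat \<times> nat) list set" where
  "hits t A = {w\<in>words t. word_map w ` E \<inter> A \<noteq> {}}"

lemma word_map_take_subset: "w \<in> words t \<Longrightarrow> word_map w ` E \<subseteq> word_map (take k w) ` E"
proof -
  assume w: "w \<in> words t"
  have "word_map w ` E = word_map (take k w) ` word_map (drop k w) ` E"
    unfolding image_comp word_map_append[symmetric] append_take_drop_id ..
  also have "\<dots> \<subseteq> word_map (take k w) ` E"
    using word_map_E_subset[OF words_drop[OF w]] by (rule image_mono)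
  finally show ?thesis .
qed

lemma hits_take: "w \<in> hits t A \<Longrightarrow> k \<le> t \<Longrightarrow> take k w \<in> hits k A"
proof -
  assume w: "w \<in> hits t A" and "k \<le> t"
  then have "take k w \<in> words k"
    by (auto simp: hits_def intro: words_take)
  then show ?thesis using w word_map_take_subset[of w t k] by (auto simp: hits_def)
qed

lemma word_map_unit_bounds:
  assumes "p \<in> word_map w ` ({0..1} \<times> {0..1})" "length w = t"
  shows "real (digit_value n (map fst w)) \<le> real n ^ t * fst p"
    "real n ^ t * fst p \<le> real (digit_value n (map fst w)) + 1"
    "real (digit_value m (map snd w)) \<le> real m ^ t * snd p"
    "real m ^ t * snd p \<le> real (digit_value m (map snd w)) + 1"
  using assms nm by (auto simp: word_map_def)

lemma E_subset_unit: "E \<subseteq> {0..1} \<times> {0..1}"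
  using E_unit by (auto simp: mem_Times_iff)

lemma word_map_bounds:
  assumes "e \<in> E" "w \<in> words t"
  shows "real (digit_value n (map fst w)) \<le> real n ^ t * fst (word_map w e)"
    "real n ^ t * fst (word_map w e) \<le> real (digit_value n (map fst w)) + 1"
    "real (digit_value m (map snd w)) \<le> real m ^ t * snd (word_map w e)"
    "real m ^ t * snd (word_map w e) \<le> real (digit_value m (map snd w)) + 1"
  using word_map_unit_bounds[of "word_map w e" w t] assms(1) E_subset_unit words_length[OF assms(2)] by blast+

text \<open>The factor 3 counts columns: the radius is at most one column width
  \<open>1 / n ^ k\<close>, so the ball can meet only the column of its centre and the two adjacent
  ones.\<close>

lemma measure_ball_le:
  assumes "k \<le> t" "finite \<V>" "r \<le> 1 / real n ^ k"
    and hit: "\<And>w. w \<in> hits t (ball z r) \<Longrightarrow> map snd w \<in> \<V>"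
  shows "measure \<mu> (ball z r \<inter> E) \<le> 3 * (\<Sum>V\<in>\<V>. real (row_weight (drop k V))) / real (card D) ^ t"
proof -
  define f where "f = \<lfloor>real n ^ k * fst z\<rfloor>"
  define B where "B = {j. int j \<in> {f - 1..f + 1}}"
  have fB: "finite B" and cB: "card B \<le> 3"
  proof -
    have *: "int ` B \<subseteq> {f - 1..f + 1}" by (auto simp: B_def)
    show "finite B" by (rule finite_imageD[OF finite_subset[OF *]]) auto
    have "card B = card (int ` B)" by (simp add: card_image)
    also have "\<dots> \<le> card {f - 1..f + 1}" by (rule card_mono[OF _ *]) simp
    finally show "card B \<le> 3" by simp
  qed
  have "measure \<mu> (ball z r \<inter> E) \<le> real (card B) * (\<Sum>V\<in>\<V>. real (row_weight (drop k V))) / real (card D) ^ t"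
  proof (rule measure_le_row_weight[OF _ assms(1,2) fB])
    show "ball z r \<inter> E \<in> sets borel" by (intro sets.Int E_sets) simp
    fix w assume w: "w \<in> words t" "word_map w ` E \<inter> (ball z r \<inter> E) \<noteq> {}"
    then have h: "w \<in> hits t (ball z r)" by (auto simp: hits_def)
    have "take k w \<in> hits k (ball z r)" using hits_take[OF h assms(1)] .
    then obtain e where e: "e \<in> E" "dist z (word_map (take k w) e) < r" and tk: "take k w \<in> words k"
      by (auto simp: hits_def)
    define x where "x = fst (word_map (take k w) e)"
    have nk: "real n ^ k > 0" using nm by simp
    have "\<bar>fst z - x\<bar> < 1 / real n ^ k"
      using e(2) assms(3) dist_fst_le[of z "word_map (take k w) e"] by (simp add: x_def dist_real_def)
    then have "\<bar>real n ^ k * fst z - real n ^ k * x\<bar> < 1" using nk by (simp only: abs_diff_scale)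
    then have "int (digit_value n (map fst (take k w))) \<in> {f - 1..f + 1}"
      using word_map_bounds(1,2)[OF e(1) tk] unfolding f_def x_def atLeastAtMost_iff by linarith
    then show "map snd w \<in> \<V> \<and> digit_value n (map fst (take k w)) \<in> B"
      using hit[OF h] by (simp add: B_def)
  qed
  also have "\<dots> \<le> 3 * (\<Sum>V\<in>\<V>. real (row_weight (drop k V))) / real (card D) ^ t"
    using cB by (intro divide_right_mono mult_right_mono sum_nonneg) auto
  finally show ?thesis .
qed

text \<open>Words with the first \<open>k\<close> digits and all rows of \<open>w\<close> fill an
  approximate square of width \<open>1 / n ^ k\<close> and height \<open>1 / m ^ t\<close>. Since it
  contains \<open>z\<close>, it lies in the ball.\<close>

lemma measure_ball_ge:
  assumes w: "w \<in> words t" and z: "z \<in> word_map w ` E" and "k \<le> t" "1 / real n ^ k + 1 / real m ^ t < \<delta>"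
  shows "real (row_weight (drop k (map snd w))) / real (card D) ^ t \<le> measure \<mu> (ball z \<delta> \<inter> E)"
proof (rule measure_ge_row_weight[OF _ w])
  show "ball z \<delta> \<inter> E \<in> sets borel" by (intro sets.Int E_sets) simp
  fix w' assume w': "w' \<in> words t" "map snd w' = map snd w" "take k w' = take k w"
  show "word_map w' ` E \<subseteq> ball z \<delta> \<inter> E"
  proof
    fix z' assume z': "z' \<in> word_map w' ` E"
    have nk: "real n ^ k > 0" "real m ^ t > 0" using nm by auto
    have "z \<in> word_map (take k w) ` E" "z' \<in> word_map (take k w) ` E"
      using word_map_take_subset[OF w, of k] word_map_take_subset[OF w'(1), of k] z z' unfolding w'(3) by (blast, blast)
    then obtain e e' where e: "e \<in> E" "z = word_map (take k w) e" and e': "e' \<in> E" "z' = word_map (take k w) e'"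
      by blast
    have tk: "take k w \<in> words k" using words_take[OF w] assms(3) .
    have "\<bar>real n ^ k * fst z - real n ^ k * fst z'\<bar> \<le> 1"
      using word_map_bounds(1,2)[OF e(1) tk] word_map_bounds(1,2)[OF e'(1) tk] unfolding e(2) e'(2) by linarith
    then have 1: "\<bar>fst z - fst z'\<bar> \<le> 1 / real n ^ k" using nk by (simp only: abs_diff_scale)
    obtain f f' where f: "f \<in> E" "z = word_map w f" and f': "f' \<in> E" "z' = word_map w' f'"
      using z z' by blast
    have "\<bar>real m ^ t * snd z - real m ^ t * snd z'\<bar> \<le> 1"
      using word_map_bounds(3,4)[OF f(1) w] word_map_bounds(3,4)[OF f'(1) w'(1), unfolded w'(2)] unfolding f(2) f'(2) by linarith
    then have 2: "\<bar>snd z - snd z'\<bar> \<le> 1 / real m ^ t" using nk by (simp only: abs_diff_scale)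
    have "dist z z' \<le> \<bar>fst z - fst z'\<bar> + \<bar>snd z - snd z'\<bar>"
      by (simp add: dist_prod_def dist_real_def sqrt_sum_squares_le_sum_abs)
    then have "dist z z' < \<delta>" using 1 2 assms(4) by linarith
    then show "z' \<in> ball z \<delta> \<inter> E" using z' word_map_E_subset[OF w'(1)] by auto
  qed
qed

text \<open>Passing from scale \<open>r\<close> to \<open>\<rho> * r\<close> changes \<open>k\<close> and \<open>t\<close> by a bounded amount, which costs a
  factor \<open>card D\<close> per level.\<close>

lemma measure_ball_compare:
  assumes "0 < \<rho>" "0 < K"
  shows "\<exists>C>0. \<forall>z r k t w. 0 < r \<longrightarrow> k \<le> t \<longrightarrow> 1 / real n ^ k \<le> K * r \<longrightarrow> 1 / real m ^ t \<le> K * r \<longrightarrow>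
    w \<in> words t \<longrightarrow> z \<in> word_map w ` E \<longrightarrow>
    real (row_weight (drop k (map snd w))) / real (card D) ^ t \<le> C * measure \<mu> (ball z (\<rho> * r) \<inter> E)"
proof -
  \<comment> \<open>After \<open>c\<close> further levels both sides of an approximate square shrink
    from at most \<open>K * r\<close> to below \<open>\<rho> * r / 2\<close>, as both bases are at
    least 2; the two halves add up to the radius.\<close>
  obtain c where c: "2 * K / \<rho> < 2 ^ c" using real_arch_pow[of 2 "2 * K / \<rho>"] by auto
  let ?N = "real (card D)"
  have N: "?N > 0" using card_D_pos by simp
  show ?thesis
  proof (intro exI[of _ "?N ^ c * ?N ^ c"] conjI allI impI)
    show "0 < ?N ^ c * ?N ^ c" using N by simp
    fix z :: "real \<times> real" and r :: real and k t w
    assume r: "0 < r" and kt: "k \<le> t" and k: "1 / real n ^ k \<le> K * r" and t: "1 / real m ^ t \<le> K * r"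
      and w: "w \<in> words t" and z: "z \<in> word_map w ` E"
    have small: "1 / real b ^ (l + c) < \<rho> * r / 2" if "2 \<le> b" "1 / real b ^ l \<le> K * r" for b l
    proof -
      have "(2::real) ^ c \<le> real b ^ c" using that(1) by (intro power_mono) auto
      then have "1 / real b ^ c \<le> 1 / 2 ^ c" using that(1) by (intro divide_left_mono) auto
      also have "\<dots> < \<rho> / (2 * K)" using c assms by (simp add: field_simps)
      finally have *: "1 / real b ^ c < \<rho> / (2 * K)" .
      have "1 / real b ^ (l + c) = (1 / real b ^ l) * (1 / real b ^ c)" by (simp add: power_add)
      also have "\<dots> \<le> (K * r) * (1 / real b ^ c)" using that(2) by (intro mult_right_mono) auto
      also have "\<dots> < (K * r) * (\<rho> / (2 * K))" using * assms r by (intro mult_strict_left_mono) auto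
      finally show ?thesis using assms by (simp add: mult.commute)
    qed
    obtain e where e: "e \<in> E" "z = word_map w e" using z by blast
    obtain v where v: "v \<in> words c" "e \<in> word_map v ` E" using E_word[OF e(1)] by blast
    have wv: "w @ v \<in> words (t + c)" "z \<in> word_map (w @ v) ` E"
      using words_append[OF w v(1)] e v(2) by (auto simp: word_map_append)
    let ?xs = "drop k (map snd w) @ map snd v"
    \<comment> \<open>Appending \<open>v\<close> cannot lower the weight, and moving the window from
      \<open>k\<close> to \<open>k + c\<close> loses at most \<open>card D ^ c\<close>. A second
      such factor comes from normalising by \<open>?N ^ (t + c)\<close> instead of
      \<open>?N ^ t\<close>.\<close>
    have "row_weight (drop k (map snd w)) \<le> row_weight (drop k (map snd w)) * row_weight (map snd v)"
      using row_weight_ge_1[of v] v(1) by (simp add: words_def)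
    also have "\<dots> = row_weight (take c ?xs) * row_weight (drop c ?xs)"
      by (metis append_take_drop_id row_weight_append)
    also have "\<dots> \<le> card D ^ c * row_weight (drop c ?xs)"
    proof (rule mult_le_mono1)
      have "row_weight (take c ?xs) \<le> card D ^ length (take c ?xs)" by (rule row_weight_le)
      also have "\<dots> \<le> card D ^ c" using card_D_pos by (intro power_increasing) auto
      finally show "row_weight (take c ?xs) \<le> card D ^ c" .
    qed
    also have "drop c ?xs = drop (k + c) (map snd (w @ v))"
      using words_length[OF w] kt by (simp add: add.commute)
    finally have "real (row_weight (drop k (map snd w))) \<le> real (card D ^ c * row_weight (drop (k + c) (map snd (w @ v))))"
      by (rule of_nat_mono)
    then have "real (row_weight (drop k (map snd w))) / ?N ^ t \<le> ?N ^ c * real (row_weight (drop (k + c) (map snd (w @ v)))) / ?N ^ t"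
      by (intro divide_right_mono) auto
    also have "\<dots> = ?N ^ c * ?N ^ c * (real (row_weight (drop (k + c) (map snd (w @ v)))) / ?N ^ (t + c))"
      using N by (simp add: power_add)
    also have "\<dots> \<le> ?N ^ c * ?N ^ c * measure \<mu> (ball z (\<rho> * r) \<inter> E)"
      using small[OF nm(5) k] small[OF nm(2) t] kt
      by (intro mult_left_mono measure_ball_ge[OF wv]) auto
    finally show "real (row_weight (drop k (map snd w))) / ?N ^ t \<le> ?N ^ c * ?N ^ c * measure \<mu> (ball z (\<rho> * r) \<inter> E)" .
  qed
qed

lemma measure_ball_pos:
  assumes "z \<in> E" "0 < \<delta>"
  shows "0 < measure \<mu> (ball z \<delta> \<inter> E)"
proof -
  obtain C where C: "C > 0" and *: "\<forall>z r k t w. 0 < r \<longrightarrow> k \<le> t \<longrightarrow> 1 / real n ^ k \<le> 1 * r \<longrightarrow>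
    1 / real m ^ t \<le> 1 * r \<longrightarrow> w \<in> words t \<longrightarrow> z \<in> word_map w ` E \<longrightarrow>
    real (row_weight (drop k (map snd w))) / real (card D) ^ t \<le> C * measure \<mu> (ball z (\<delta> * r) \<inter> E)"
    using measure_ball_compare[OF assms(2) zero_less_one] by blast
  \<comment> \<open>The empty word at \<open>k = t = 0\<close>, \<open>r = 1\<close> has weight 1,
    so the comparison at ratio \<open>\<delta>\<close> bounds the mass away from zero.\<close>
  have "1 \<le> C * measure \<mu> (ball z \<delta> \<inter> E)"
    using *[rule_format, of 1 0 0 "[]" z] assms by (simp add: words_def row_weight_def)
  then have "0 < C * measure \<mu> (ball z \<delta> \<inter> E)" by linarith
  then show ?thesis using C by (simp add: zero_less_mult_iff)
qed

lemma word_map_unit_diam: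
  assumes "p \<in> word_map w ` ({0..1} \<times> {0..1})" "p' \<in> word_map w ` ({0..1} \<times> {0..1})" "length w = t"
  shows "\<bar>fst p - fst p'\<bar> \<le> 1 / real n ^ t" "\<bar>snd p - snd p'\<bar> \<le> 1 / real m ^ t"
    "dist p p' \<le> 2 / real m ^ t"
proof -
  have pos: "real n ^ t > 0" "real m ^ t > 0" using nm by auto
  note b = word_map_unit_bounds[OF assms(1,3)] word_map_unit_bounds[OF assms(2,3)]
  have "\<bar>real n ^ t * fst p - real n ^ t * fst p'\<bar> \<le> 1" using b by linarith
  then show 1: "\<bar>fst p - fst p'\<bar> \<le> 1 / real n ^ t" using pos by (simp only: abs_diff_scale)
  have "\<bar>real m ^ t * snd p - real m ^ t * snd p'\<bar> \<le> 1" using b by linarith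
  then show 2: "\<bar>snd p - snd p'\<bar> \<le> 1 / real m ^ t" using pos by (simp only: abs_diff_scale)
  have "real m ^ t \<le> real n ^ t" using nm by (intro power_mono) auto
  then have "1 / real n ^ t \<le> 1 / real m ^ t" using pos by (intro divide_left_mono) auto
  moreover have "dist p p' \<le> \<bar>fst p - fst p'\<bar> + \<bar>snd p - snd p'\<bar>"
    by (simp add: dist_prod_def dist_real_def sqrt_sum_squares_le_sum_abs)
  ultimately show "dist p p' \<le> 2 / real m ^ t" using 1 2 by simp
qed

lemma m_power_small: "0 < \<epsilon> \<Longrightarrow> \<exists>t\<ge>q. 1 / real m ^ t < \<epsilon>"
proof -
  assume e: "0 < \<epsilon>"
  obtain s where s: "1 / \<epsilon> < real m ^ s" using real_arch_pow[of "real m" "1 / \<epsilon>"] nm by auto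
  have "real m ^ s \<le> real m ^ max s q" using nm by (intro power_increasing) auto
  then have "1 / \<epsilon> < real m ^ max s q" using s by linarith
  then have "1 / real m ^ max s q < \<epsilon>" using e nm by (simp add: field_simps)
  then show ?thesis by (intro exI[of _ "max s q"]) simp
qed

lemma map_words: "\<forall>j. d j \<in> D \<Longrightarrow> map d [0..<k] \<in> words k"
  by (auto simp: words_def)

section \<open>Codings and rows near a point\<close>

text \<open>Codings are defined through images of the unit square, masses through images of
  \<open>E\<close>. The two agree: deeper squares supply points of the image of \<open>E\<close>
  arbitrarily close to \<open>z\<close>, and that image is closed. Conversely, shrinking diameters
  leave only one point in the intersection.\<close>

lemma is_coding_iff: "is_coding n m D d z \<longleftrightarrow> (\<forall>j. d j \<in> D) \<and> (\<forall>k. z \<in> word_map (map d [0..<k]) ` E)"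
proof (intro iffI conjI)
  assume c: "is_coding n m D d z"
  then show D: "\<forall>j. d j \<in> D" by (simp add: is_coding_def)
  have zk: "z \<in> word_map (map d [0..<k]) ` ({0..1} \<times> {0..1})" if "k \<ge> 1" for k
    using c that unfolding is_coding_def bm_word_eq by blast
  show "\<forall>k. z \<in> word_map (map d [0..<k]) ` E"
  proof
    fix k
    have "z \<in> closure (word_map (map d [0..<k]) ` E)"
      unfolding closure_approachable
    proof (intro allI impI)
      fix \<epsilon> :: real assume "\<epsilon> > 0"
      then obtain t where t: "t \<ge> Suc k" "1 / real m ^ t < \<epsilon> / 2" using m_power_small[of "\<epsilon> / 2" "Suc k"] by auto
      obtain e where e: "e \<in> E" using E_ne by blast
      let ?p = "word_map (map d [0..<t]) e"
      have "?p \<in> word_map (take k (map d [0..<t])) ` E"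
        using word_map_take_subset[OF map_words[OF D]] e by blast
      also have "take k (map d [0..<t]) = map d [0..<k]" using t(1) by (simp add: take_map)
      finally have "?p \<in> word_map (map d [0..<k]) ` E" .
      moreover have "dist ?p z \<le> 2 / real m ^ t"
        using zk[of t] t(1) e E_subset_unit by (intro word_map_unit_diam(3)[of _ "map d [0..<t]"]) auto
      then have "dist ?p z < \<epsilon>" using t(2) by simp
      ultimately show "\<exists>y\<in>word_map (map d [0..<k]) ` E. dist y z < \<epsilon>" by blast
    qed
    then show "z \<in> word_map (map d [0..<k]) ` E"
      using compact_imp_closed[OF compact_word_map_E] by simp
  qed
next
  assume *: "(\<forall>j. d j \<in> D) \<and> (\<forall>k. z \<in> word_map (map d [0..<k]) ` E)"
  have zk: "z \<in> word_map (map d [0..<k]) ` ({0..1} \<times> {0..1})" for k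
    by (rule subsetD[OF image_mono[OF E_subset_unit]]) (use * in simp)
  have "p = z" if "\<forall>k\<ge>1. p \<in> word_map (map d [0..<k]) ` ({0..1} \<times> {0..1})" for p
  proof (rule ccontr)
    assume "p \<noteq> z"
    then obtain t where t: "t \<ge> 1" "1 / real m ^ t < dist p z / 2"
      using m_power_small[of "dist p z / 2" 1] by auto
    have "dist p z \<le> 2 / real m ^ t"
      using that zk t by (intro word_map_unit_diam(3)[of _ "map d [0..<t]"]) auto
    then show False using t by simp
  qed
  then have "(\<Inter>k\<in>{1..}. word_map (map d [0..<k]) ` ({0..1} \<times> {0..1})) \<subseteq> {z}" by auto
  moreover have "{z} \<subseteq> (\<Inter>k\<in>{1..}. word_map (map d [0..<k]) ` ({0..1} \<times> {0..1}))" using zk by simp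
  ultimately show "is_coding n m D d z"
    using * unfolding is_coding_def bm_word_eq by (intro conjI equalityI) simp_all
qed

text \<open>A preimage \<open>e\<close> of \<open>z\<close> in \<open>E\<close> has itself a digit
  and a preimage in \<open>E\<close>. Iterating a fixed choice \<open>h\<close> of these yields the
  orbit \<open>g\<close>, whose digits continue \<open>w\<close> forever.\<close>

lemma coding_extend:
  assumes w: "w \<in> words q" and z: "z \<in> word_map w ` E"
  shows "\<exists>d. is_coding n m D d z \<and> map d [0..<q] = w"
proof -
  obtain e where e: "e \<in> E" "z = word_map w e" using z by blast
  have "\<forall>x\<in>E. \<exists>p. fst p \<in> D \<and> snd p \<in> E \<and> x = bm_map n m (fst p) (snd p)"
  proof
    fix x assume "x \<in> E"
    then obtain c y where "c \<in> D" "y \<in> E" "x = bm_map n m c y" using E_eq by blast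
    then show "\<exists>p. fst p \<in> D \<and> snd p \<in> E \<and> x = bm_map n m (fst p) (snd p)"
      by (intro exI[of _ "(c, y)"]) simp
  qed
  from bchoice[OF this] obtain h where
    h: "\<forall>x\<in>E. fst (h x) \<in> D \<and> snd (h x) \<in> E \<and> x = bm_map n m (fst (h x)) (snd (h x))" ..
  define g where "g i = ((\<lambda>x. snd (h x)) ^^ i) e" for i
  have g: "g i \<in> E" for i by (induction i) (use e h in \<open>auto simp: g_def\<close>)
  define d where "d i = (if i < q then w ! i else fst (h (g (i - q))))" for i
  have lw: "length w = q" using words_length[OF w] .
  have dq: "map d [0..<q] = w" by (rule nth_equalityI) (auto simp: d_def lw)
  have dD: "\<forall>j. d j \<in> D"
    using h g w by (auto simp: d_def words_def)
  have ext: "z = word_map (map d [0..<q + j]) (g j)" for j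
  proof (induction j)
    case 0
    then show ?case using e dq by (simp add: g_def)
  next
    case (Suc j)
    have "g j = bm_map n m (d (q + j)) (g (Suc j))" using h g[of j] by (simp add: d_def g_def)
    then show ?case using Suc by (simp add: word_map_append word_map_Cons)
  qed
  have "z \<in> word_map (map d [0..<k]) ` E" for k
  proof -
    have "z \<in> word_map (take k (map d [0..<q + k])) ` E"
      using word_map_take_subset[OF map_words[OF dD], of "q + k" k] ext[of k] g[of k] by blast
    then show ?thesis by (simp add: take_map)
  qed
  then show ?thesis using dD dq is_coding_iff by blast
qed

text \<open>Rows of height \<open>1 / m ^ length w\<close> are numbered upwards from 0, so that
  adjacent rows become consecutive integers.\<close>

definition row_num :: "(nat \<times> nat) list \<Rightarrow> nat" where
  "row_num w = digit_value m (map snd w)"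

lemma row_num_eqD: "u \<in> words t \<Longrightarrow> w \<in> words t \<Longrightarrow> row_num u = row_num w \<Longrightarrow> map snd u = map snd w"
  using words_digits(2)[of u t] words_digits(2)[of w t]
  by (intro digit_value_inj[of _ _ m]) (auto simp: row_num_def words_length)

text \<open>A row of level \<open>q\<close> splits into \<open>m ^ (t - q)\<close> consecutive rows
  of level \<open>t\<close>.\<close>

lemma row_num_take:
  assumes "w \<in> words t" "q \<le> t"
  shows "row_num (take q w) * m ^ (t - q) \<le> row_num w"
    "row_num w < (row_num (take q w) + 1) * m ^ (t - q)"
proof -
  have l: "length (drop q w) = t - q" using assms by (simp add: words_length)
  have *: "row_num w = row_num (take q w) * m ^ (t - q) + row_num (drop q w)"
    unfolding row_num_def by (subst append_take_drop_id[of q w, symmetric], subst map_append, subst digit_value_append) (simp add: l del: length_drop)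
  have "row_num (drop q w) < m ^ (t - q)"
    using digit_value_less[OF words_digits(2)[OF words_drop[OF assms(1), of q]]] by (simp add: row_num_def l del: length_drop)
  then show "row_num (take q w) * m ^ (t - q) \<le> row_num w"
    "row_num w < (row_num (take q w) + 1) * m ^ (t - q)" using * by auto
qed

lemma hits_row_num:
  assumes "w \<in> hits t (ball z r)"
  shows "real (row_num w) < real m ^ t * snd z + real m ^ t * r"
    "real m ^ t * snd z - real m ^ t * r < real (row_num w) + 1"
proof -
  obtain e where w: "w \<in> words t" and e: "e \<in> E" "dist z (word_map w e) < r"
    using assms by (auto simp: hits_def)
  have "\<bar>snd z - snd (word_map w e)\<bar> < r"
    using e(2) dist_snd_le[of z "word_map w e"] by (simp add: dist_real_def)
  then have "\<bar>snd z - snd (word_map w e)\<bar> < (real m ^ t * r) / real m ^ t" using nm by simp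
  moreover have "real m ^ t > 0" using nm by simp
  ultimately have "\<bar>real m ^ t * snd z - real m ^ t * snd (word_map w e)\<bar> < real m ^ t * r"
    by (simp only: abs_diff_scale)
  then show "real (row_num w) < real m ^ t * snd z + real m ^ t * r"
    "real m ^ t * snd z - real m ^ t * r < real (row_num w) + 1"
    using word_map_bounds(3,4)[OF e(1) w] unfolding row_num_def by linarith+
qed

text \<open>Both rows contain the height of \<open>z\<close>, so the upper number never exceeds the
  lower one plus 1, and a strict inequality forces them to be adjacent with \<open>z\<close> on the
  common edge. One level deeper, adjacency requires
  \<open>m + snd (d k) \<le> snd (d' k) + 1\<close>, which only the digits \<open>0\<close> and
  \<open>m - 1\<close> satisfy.\<close>

lemma overlap_tails:
  assumes "is_coding n m D d z" "is_coding n m D d' z" "row_num (map d' [0..<q]) < row_num (map d [0..<q])"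
    "q \<le> t"
  shows "real m ^ t * snd z = real (row_num (map d [0..<t]))"
    "row_num (map d [0..<t]) = row_num (map d' [0..<t]) + 1"
    "snd (d t) = 0" "snd (d' t) = m - 1"
proof -
  have D: "\<forall>j. d j \<in> D" "\<forall>j. d' j \<in> D" and c: "z \<in> word_map (map d [0..<k]) ` E" "z \<in> word_map (map d' [0..<k]) ` E" for k
    using assms(1,2) by (simp_all add: is_coding_iff)
  have b: "real (row_num (map d [0..<k])) \<le> real m ^ k * snd z"
     "real m ^ k * snd z \<le> real (row_num (map d' [0..<k])) + 1" for k
  proof -
    obtain e e' where "e \<in> E" "z = word_map (map d [0..<k]) e" "e' \<in> E" "z = word_map (map d' [0..<k]) e'"
      using c[of k] by blast
    then show "real (row_num (map d [0..<k])) \<le> real m ^ k * snd z"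
     "real m ^ k * snd z \<le> real (row_num (map d' [0..<k])) + 1"
      using word_map_bounds(3)[of e, OF _ map_words[OF D(1), of k]] word_map_bounds(4)[of e', OF _ map_words[OF D(2), of k]]
      unfolding row_num_def by simp_all
  qed
  have S: "row_num (map f [0..<Suc k]) = m * row_num (map f [0..<k]) + snd (f k)" for f k
    by (simp add: row_num_def digit_value_append)
  have step: "snd (d k) = 0 \<and> snd (d' k) = m - 1 \<and> row_num (map d [0..<Suc k]) = row_num (map d' [0..<Suc k]) + 1"
    if "row_num (map d [0..<k]) = row_num (map d' [0..<k]) + 1" for k
  proof -
    have "real (row_num (map d [0..<Suc k])) \<le> real (row_num (map d' [0..<Suc k]) + 1)"
      using b[of "Suc k"] by simp
    then have "row_num (map d [0..<Suc k]) \<le> row_num (map d' [0..<Suc k]) + 1"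
      by (simp only: of_nat_le_iff)
    then have "m + snd (d k) \<le> snd (d' k) + 1" unfolding S that by simp
    moreover have "snd (d' k) < m" using D_less D by blast
    ultimately have "snd (d k) = 0" "snd (d' k) = m - 1" by auto
    then show ?thesis using nm unfolding S that by simp
  qed
  have *: "row_num (map d [0..<t]) = row_num (map d' [0..<t]) + 1"
    using assms(4)
  proof (induction t rule: dec_induct)
    case base
    have "real (row_num (map d [0..<q])) \<le> real (row_num (map d' [0..<q]) + 1)" using b[of q] by simp
    then have "row_num (map d [0..<q]) \<le> row_num (map d' [0..<q]) + 1"
      by (simp only: of_nat_le_iff)
    then show ?case using assms(3) by simp
  qed (use step in blast)
  then show "row_num (map d [0..<t]) = row_num (map d' [0..<t]) + 1" .
  show "snd (d t) = 0" "snd (d' t) = m - 1" using step[OF *] by auto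
  show "real m ^ t * snd z = real (row_num (map d [0..<t]))" using b[of t] * by simp
qed

lemma vertical_overlapE:
  assumes "z \<in> vertical_overlap n m D E"
  obtains d d' q where "is_coding n m D d z" "is_coding n m D d' z"
    "row_num (map d' [0..<q]) < row_num (map d [0..<q])"
proof -
  obtain d d' where c: "is_coding n m D d z" "is_coding n m D d' z" and ne: "snd \<circ> d \<noteq> snd \<circ> d'"
    using assms by (auto simp: vertical_overlap_def)
  obtain i where i: "snd (d i) \<noteq> snd (d' i)" using ne by (auto simp: fun_eq_iff)
  have D: "\<forall>j. d j \<in> D" "\<forall>j. d' j \<in> D" using c by (simp_all add: is_coding_iff)
  have "row_num (map d' [0..<Suc i]) \<noteq> row_num (map d [0..<Suc i])"
  proof
    assume "row_num (map d' [0..<Suc i]) = row_num (map d [0..<Suc i])"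
    then have "map snd (map d' [0..<Suc i]) = map snd (map d [0..<Suc i])"
      using row_num_eqD map_words D by blast
    then show False using i by simp
  qed
  then show thesis using that c by (metis linorder_neqE_nat)
qed

text \<open>Used in contrapositive form: off the overlap set, all cells of one level that contain
  \<open>z\<close> have the same row digits.\<close>

lemma vertical_overlapI:
  assumes "u \<in> words q" "w \<in> words q" "z \<in> word_map u ` E" "z \<in> word_map w ` E" "map snd u \<noteq> map snd w"
  shows "z \<in> vertical_overlap n m D E"
proof -
  obtain d d' where d: "is_coding n m D d z" "map d [0..<q] = u" "is_coding n m D d' z" "map d' [0..<q] = w"
    using coding_extend[OF assms(1,3)] coding_extend[OF assms(2,4)] by blast
  have "snd \<circ> d \<noteq> snd \<circ> d'"
  proof
    assume "snd \<circ> d = snd \<circ> d'"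
    then have "map (snd \<circ> d) [0..<q] = map (snd \<circ> d') [0..<q]" by simp
    then show False using assms(5) d by (metis map_map)
  qed
  moreover have "z \<in> E" using assms(1,3) word_map_E_subset by blast
  ultimately show ?thesis using d unfolding vertical_overlap_def by blast
qed

text \<open>The distance from \<open>m ^ t * y\<close> to the integers is multiplied by \<open>m\<close> when \<open>t\<close> grows by one, until
  it first reaches \<open>1 / (m + 1)\<close>; at that moment it has not yet jumped past \<open>m / (m + 1)\<close>.\<close>

lemma middle_scale:
  assumes "\<And>t (j :: int). real m ^ t * y \<noteq> j"
  shows "\<exists>t'\<ge>t. \<exists>J :: int. J + 1 / (m + 1) \<le> real m ^ t' * y \<and> real m ^ t' * y \<le> J + m / (m + 1)"
proof -
  define j where "j = \<lfloor>real m ^ t * y\<rfloor>"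
  have j: "j < real m ^ t * y" "real m ^ t * y < j + 1"
    using assms[of t j] unfolding j_def by linarith+
  have m1: "real m / (m + 1) = 1 - 1 / (m + 1)" using nm by (simp add: field_simps)
  have m0: "0 < real m + 1" by simp
  have scale: "\<exists>i. 1 / (real m + 1) \<le> real m ^ i * \<delta> \<and> real m ^ i * \<delta> \<le> m / (m + 1)"
    if d: "0 < \<delta>" "\<delta> < 1 / (real m + 1)" for \<delta>
  proof -
    \<comment> \<open>The factor \<open>m + 1\<close> normalises the threshold to 1. Then
      \<open>m ^ k * \<delta>\<close> is still at most \<open>1 / (m + 1)\<close>, while one more
      factor \<open>m\<close> passes the threshold and reaches at most
      \<open>m / (m + 1)\<close>.\<close>
    obtain k where k: "\<delta> * (m + 1) \<le> 1 / real m ^ k" "1 / real m ^ Suc k < \<delta> * (m + 1)"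
    proof -
      have "0 < \<delta> * (m + 1)" using d by simp
      moreover have "\<delta> * (m + 1) \<le> 1" using d by (simp add: pos_less_divide_eq add.commute)
      ultimately
show thesis using ex_scale[of m "\<delta> * (m + 1)"] nm(2) that by blast
    qed
    have pos: "real m ^ k > 0" using nm by simp
    have "\<delta> * (m + 1) * real m ^ k \<le> 1" using k(1) pos by (simp only: pos_le_divide_eq)
    then have "real m * (\<delta> * (m + 1) * real m ^ k) \<le> real m * 1" by (rule mult_left_mono) simp
    then have "real m ^ Suc k * (\<delta> * (m + 1)) \<le> m" by (simp add: mult_ac)
    moreover have "real m ^ Suc k > 0" using nm by simp
    then have "1 < \<delta> * (m + 1) * real m ^ Suc k" using k(2) by (simp only: pos_divide_less_eq)
    then have "1 \<le> real m ^ Suc k * (\<delta> * (m + 1))" by (simp add: mult_ac)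
    ultimately show ?thesis
      by (intro exI[of _ "Suc k"] conjI)
        (simp_all only: pos_le_divide_eq pos_divide_le_eq m0 mult.assoc of_nat_add of_nat_1)
  qed
  consider "real m ^ t * y - j < 1 / (real m + 1)" | "j + 1 - real m ^ t * y < 1 / (real m + 1)"
    | "j + 1 / (m + 1) \<le> real m ^ t * y \<and> real m ^ t * y \<le> j + m / (m + 1)"
    using m1 unfolding of_nat_add of_nat_1 by linarith
  then show ?thesis
  proof cases
    case 1
    then obtain i where i: "1 / (real m + 1) \<le> real m ^ i * (real m ^ t * y - j)"
        "real m ^ i * (real m ^ t * y - j) \<le> m / (m + 1)"
      using scale[of "real m ^ t * y - j"] j by auto
    have "real m ^ (t + i) * y = of_int (int m ^ i * j) + real m ^ i * (real m ^ t * y - j)"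
      by (simp add: power_add algebra_simps)
    then show ?thesis using i by (intro exI[of _ "t + i"] conjI exI[of _ "int m ^ i * j"]) (auto simp: add.commute)
  next
    case 2
    then obtain i where i: "1 / (real m + 1) \<le> real m ^ i * (j + 1 - real m ^ t * y)"
        "real m ^ i * (j + 1 - real m ^ t * y) \<le> m / (m + 1)"
      using scale[of "j + 1 - real m ^ t * y"] j by auto
    \<comment> \<open>The distance is now measured downwards from the integer above, hence the
      \<open>- 1\<close> in the new integer part.\<close>
    have "real m ^ (t + i) * y = of_int (int m ^ i * (j + 1) - 1) + 1 - real m ^ i * (j + 1 - real m ^ t * y)"
      by (simp add: power_add algebra_simps)
    then show ?thesis using i m1 by (intro exI[of _ "t + i"] conjI exI[of _ "int m ^ i * (j + 1) - 1"]) (auto simp: add.commute)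
  next
    case 3
    then show ?thesis by blast
  qed
qed

text \<open>If \<open>snd z\<close> is an \<open>m\<close>-adic rational, then \<open>E\<close> may still meet both sides of the horizontal line
  through \<open>z\<close>, but only one side accumulates at \<open>z\<close>.\<close>

lemma single_row_scales:
  assumes z: "z \<in> E" "z \<notin> vertical_overlap n m D E" and "0 < \<epsilon>"
  shows "\<exists>r t. 0 < r \<and> r < \<epsilon> \<and> 1 / real m ^ t \<le> (real m + 1) * r \<and>
    (\<forall>u\<in>hits t (ball z r). \<forall>w\<in>hits t (ball z r). map snd u = map snd w)"
proof (cases "\<exists>q (p :: int). real m ^ q * snd z = p")
  case False
  obtain t0 where t0: "1 / real m ^ t0 < \<epsilon>" using m_power_small[OF assms(3), of 0] by blast
  obtain t and J :: int where t: "t \<ge> t0" "J + 1 / (m + 1) \<le> real m ^ t * snd z" "real m ^ t * snd z \<le> J + m / (m + 1)"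
    using middle_scale[of "snd z" t0] False by blast
  \<comment> \<open>In units of the row height, \<open>r\<close> is exactly the margin that
    \<open>middle_scale\<close> leaves on both sides; since balls are open, only row
    \<open>J\<close> is met.\<close>
  define r where "r = 1 / (real m ^ t * (m + 1))"
  have "1 / real m ^ t \<le> 1 / real m ^ t0" using t(1) nm by (intro divide_left_mono power_increasing) auto
  moreover have "r \<le> 1 / real m ^ t" unfolding r_def using nm by (intro divide_left_mono) auto
  ultimately have "r < \<epsilon>" using t0 by linarith
  have mr: "real m ^ t * r = 1 / (m + 1)" using nm by (simp add: r_def)
  have m1: "real m / (m + 1) + 1 / (m + 1) = 1" using nm by (simp add: field_simps)
  have J: "int (row_num w) = J" if "w \<in> hits t (ball z r)" for w
    using hits_row_num[OF that] t(2,3) m1 unfolding mr by linarith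
  have "map snd u = map snd w" if "u \<in> hits t (ball z r)" "w \<in> hits t (ball z r)" for u w
  proof -
    have "int (row_num u) = int (row_num w)"
      using J that by simp
    then show ?thesis using row_num_eqD[of u t w] that by (simp add: hits_def)
  qed
  moreover have "0 < r" using nm by (simp add: r_def)
  moreover have "1 / real m ^ t \<le> (real m + 1) * r" unfolding r_def using nm by (simp add: add.commute)
  ultimately show ?thesis using \<open>r < \<epsilon>\<close> by blast
next
  case True
  then obtain q and p :: int where p: "real m ^ q * snd z = p" by blast
  obtain w0 where w0: "w0 \<in> words q" "z \<in> word_map w0 ` E" using E_word[OF z(1)] by blast
  \<comment> \<open>The level \<open>q\<close> cells outside the row of \<open>w0\<close>. Their
    union is closed and misses \<open>z\<close>, so small balls around \<open>z\<close> meet only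
    one row of level \<open>q\<close>.\<close>
  define U where "U = (\<Union>w\<in>{w\<in>words q. map snd w \<noteq> map snd w0}. word_map w ` E)"
  have "closed U" unfolding U_def
    by (intro closed_UN) (auto intro: compact_imp_closed compact_word_map_E)
  moreover have "z \<notin> U"
    using vertical_overlapI[OF _ w0(1) _ w0(2)] z(2) by (auto simp: U_def)
  ultimately obtain r0 where r0: "r0 > 0" "ball z r0 \<subseteq> - U"
    using open_contains_ball[of "- U"] by (auto simp: open_Compl)
  obtain t where t: "t \<ge> q" "1 / real m ^ t < min \<epsilon> r0" using m_power_small[of "min \<epsilon> r0" q] r0 assms(3) by auto
  define r where "r = 1 / real m ^ t"
  define S where "S = m ^ (t - q)"
  have mr: "real m ^ t * r = 1" using nm by (simp add: r_def)
  have "real m ^ t = real m ^ (t - q) * real m ^ q" using t(1) by (simp add: power_add[symmetric])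
  then have M: "real m ^ t * snd z = of_int (p * int S)" using p by (simp add: S_def mult.assoc)
  have *: "map snd (take q w) = map snd w0 \<and> (int (row_num w) = p * int S \<or> int (row_num w) = p * int S - 1)"
    if w: "w \<in> hits t (ball z r)" for w
  proof -
    have "take q w \<in> hits q (ball z r)" using hits_take[OF w t(1)] .
    moreover have "ball z r \<inter> U = {}"
      using r0 t(2) subset_ball[of r r0 z] unfolding r_def by auto
    ultimately have "map snd (take q w) = map snd w0" by (auto simp: hits_def U_def)
    moreover have "int (row_num w) < p * int S + 1" "p * int S < int (row_num w) + 2"
      using hits_row_num[OF w] unfolding mr M by linarith+
    ultimately show ?thesis by linarith
  qed
  \<comment> \<open>The two candidate rows have numbers \<open>p * S\<close> and
    \<open>p * S - 1\<close>. Since \<open>S\<close> is the number of level \<open>t\<close> rows in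
    one level \<open>q\<close> row, they lie in different level \<open>q\<close> rows, and only that
    of \<open>w0\<close> is available.\<close>
  have no: False if u: "u \<in> hits t (ball z r)" "int (row_num u) = p * int S" 
    and w: "w \<in> hits t (ball z r)" "int (row_num w) = p * int S - 1" for u w
  proof -
    have Spos: "int S > 0" using nm by (simp add: S_def)
    have eq: "row_num (take q u) = row_num w0" "row_num (take q w) = row_num w0"
      using *[OF u(1)] *[OF w(1)] by (auto simp: row_num_def)
    have "row_num u < (row_num w0 + 1) * S"
      using row_num_take(2)[of u t q] u t(1) by (simp add: hits_def eq S_def)
    then have "int (row_num u) < int ((row_num w0 + 1) * S)" by (simp only: of_nat_less_iff)
    then have "p * int S < (int (row_num w0) + 1) * int S" using u(2) by (simp only: of_nat_mult of_nat_add of_nat_1)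
    then have 1: "p < int (row_num w0) + 1" using Spos by (simp add: mult_less_cancel_right)
    have "row_num w0 * S \<le> row_num w"
      using row_num_take(1)[of w t q] w t(1) by (simp add: hits_def eq S_def)
    then have "int (row_num w0 * S) \<le> int (row_num w)" by (simp only: of_nat_le_iff)
    then have "int (row_num w0) * int S < p * int S" using w(2) by simp
    then have "int (row_num w0) < p" using Spos by (simp add: mult_less_cancel_right)
    with 1 show False by simp
  qed
  have "map snd u = map snd w" if uw: "u \<in> hits t (ball z r)" "w \<in> hits t (ball z r)" for u w
  proof -
    have "row_num u = row_num w" using *[OF uw(1)] *[OF uw(2)] no uw by (metis of_nat_eq_iff)
    then show ?thesis using row_num_eqD uw by (auto simp: hits_def)
  qed
  moreover have "0 < r" "r < \<epsilon>" using nm t by (auto simp: r_def)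
  moreover have "1 / real m ^ t \<le> (real m + 1) * r" using \<open>0 < r\<close> nm unfolding r_def[symmetric] by simp
  ultimately show ?thesis by blast
qed

section \<open>Mass ratios of balls\<close>

text \<open>At a radius from \<open>single_row_scales\<close> one row sequence carries the large
  ball and every cell containing a centre \<open>z'\<close>. The same row weight thus bounds the
  large mass from above and the small one from below, and cancels.\<close>

lemma ball_ratio_bounded_off_overlap:
  assumes z: "z \<in> E" "z \<notin> vertical_overlap n m D E" and "0 < \<rho>"
  shows "\<exists>C>0. \<forall>\<epsilon>>0. \<exists>r. 0 < r \<and> r < \<epsilon> \<and>
    (\<forall>z'\<in>E. dist z z' < r \<longrightarrow> measure \<mu> (ball z r \<inter> E) \<le> C * measure \<mu> (ball z' (\<rho> * r) \<inter> E))"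
proof -
  let ?K = "real n + real m + 1"
  have "0 < ?K" by simp
  then obtain C where C: "C > 0" and cmp: "\<forall>z r k t w. 0 < r \<longrightarrow> k \<le> t \<longrightarrow> 1 / real n ^ k \<le> ?K * r \<longrightarrow>
    1 / real m ^ t \<le> ?K * r \<longrightarrow> w \<in> words t \<longrightarrow> z \<in> word_map w ` E \<longrightarrow>
    real (row_weight (drop k (map snd w))) / real (card D) ^ t \<le> C * measure \<mu> (ball z (\<rho> * r) \<inter> E)"
    using measure_ball_compare[OF assms(3)] by meson
  show ?thesis
  proof (rule exI[of _ "3 * C"], intro conjI allI impI)
    show "0 < 3 * C" using C by simp
    fix \<epsilon> :: real assume "\<epsilon> > 0"
    then have "0 < min \<epsilon> 1" by simp
    from single_row_scales[OF z this] obtain r t where r: "0 < r" "r < min \<epsilon> 1"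
      and t: "1 / real m ^ t \<le> (real m + 1) * r"
      and uniq: "\<forall>u\<in>hits t (ball z r). \<forall>w\<in>hits t (ball z r). map snd u = map snd w" by blast
    have hit: "w \<in> hits t (ball z r)" if "w \<in> words t" "z' \<in> word_map w ` E" "dist z z' < r" for w z'
      using that by (auto simp: hits_def)
    obtain w0 where w0: "w0 \<in> words t" "z \<in> word_map w0 ` E" using E_word[OF z(1)] by blast
    have h0: "w0 \<in> hits t (ball z r)" using hit[OF w0] r by simp
    define V where "V = map snd w0"
    obtain k0 where k0: "r \<le> 1 / real n ^ k0" "1 / real n ^ Suc k0 < r"
      using ex_scale[OF nm(5) r(1)] r(2) by (metis less_eq_real_def min_less_iff_conj)
    \<comment> \<open>The row level \<open>t\<close> is prescribed and may fall short of
      \<open>k0\<close>. Truncation restores \<open>k \<le> t\<close>; columns of level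
      \<open>t\<close> are still narrow enough, being no wider than the rows are high.\<close>
    define k where "k = min k0 t"
    have kt: "k \<le> t" by (simp add: k_def)
    have "1 / real n ^ k0 \<le> 1 / real n ^ k"
      using nm by (intro divide_left_mono power_increasing) (auto simp: k_def)
    then have rk: "r \<le> 1 / real n ^ k" using k0 by linarith
    have Kr: "real n * r \<le> ?K * r" "(real m + 1) * r \<le> ?K * r" using r by (auto simp: algebra_simps)
    have nk: "1 / real n ^ k \<le> ?K * r"
    proof (cases "k0 \<le> t")
      case True
      have "1 / real n ^ k0 = real n * (1 / real n ^ Suc k0)" using nm by simp
      also have "\<dots> \<le> real n * r" using k0 by (intro mult_left_mono) auto
      finally show ?thesis using Kr True by (simp add: k_def)
    next
      case False
      have "1 / real n ^ t \<le> 1 / real m ^ t" using nm by (intro divide_left_mono power_mono) auto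
      moreover have "k = t" using False by (simp add: k_def)
      ultimately show ?thesis using t Kr by (simp only:)
    qed
    have "measure \<mu> (ball z r \<inter> E) \<le> 3 * (\<Sum>V\<in>{V}. real (row_weight (drop k V))) / real (card D) ^ t"
      by (rule measure_ball_le[OF kt _ rk]) (use uniq h0 in \<open>unfold V_def, blast+\<close>)
    then have up: "measure \<mu> (ball z r \<inter> E) \<le> 3 * (real (row_weight (drop k V)) / real (card D) ^ t)" by simp
    have "measure \<mu> (ball z r \<inter> E) \<le> 3 * C * measure \<mu> (ball z' (\<rho> * r) \<inter> E)"
      if z': "z' \<in> E" "dist z z' < r" for z'
    proof -
      obtain w where w: "w \<in> words t" "z' \<in> word_map w ` E" using E_word[OF z'(1)] by blast
      have "map snd w = V" using hit[OF w z'(2)] h0 uniq unfolding V_def by blast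
      moreover have "real (row_weight (drop k (map snd w))) / real (card D) ^ t \<le> C * measure \<mu> (ball z' (\<rho> * r) \<inter> E)"
        using cmp[rule_format, OF r(1) kt nk _ w] t Kr by linarith
      ultimately show ?thesis using up by simp
    qed
    then show "\<exists>r. 0 < r \<and> r < \<epsilon> \<and>
      (\<forall>z'\<in>E. dist z z' < r \<longrightarrow> measure \<mu> (ball z r \<inter> E) \<le> 3 * C * measure \<mu> (ball z' (\<rho> * r) \<inter> E))"
      using r by auto
  qed
qed

text \<open>The map of a digit in row 0 divides heights by \<open>m\<close>, so the least height on
  \<open>E\<close> cannot be positive.\<close>

lemma E_bottom:
  assumes "0 < fiber D 0"
  shows "\<exists>e\<in>E. snd e = 0"
proof -
  obtain e where e: "e \<in> E" "\<forall>z\<in>E. snd e \<le> snd z"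
    using continuous_attains_inf[OF compact_E E_ne continuous_on_snd[OF continuous_on_id]] by blast
  have "{i. (i, 0) \<in> D} \<noteq> {}" using assms by (auto simp: fiber_def card_gt_0_iff)
  then obtain i where i: "(i, 0) \<in> D" by blast
  then have "bm_map n m (i, 0) e \<in> E" using E_eq e(1) by blast
  then have "snd e \<le> snd e / real m" using e(2) by (force simp: bm_map_def)
  then have "snd e * real m \<le> snd e" using nm by (simp add: pos_le_divide_eq)
  then have "snd e * (real m - 1) \<le> 0" by (simp add: algebra_simps)
  then have "snd e \<le> 0" using nm by (simp add: mult_le_0_iff)
  moreover have "snd e \<ge> 0" using E_unit[OF e(1)] by simp
  ultimately show ?thesis using e by (intro bexI[of _ e]) auto
qed

text \<open>\<open>\<kappa> * ln (1 / r)\<close> approximates \<open>t - k\<close>, the number of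
  row digits that enter a weight, and \<open>L\<close> is the gain per digit of the upper row over
  the lower one. The upper bound serves all admissible centres, the lower bound needs a single
  centre.\<close>

lemma ball_ratio_at_overlap:
  assumes z: "z \<in> vertical_overlap n m D E" and rho: "0 < \<rho>" "\<rho> < 1 / real n ^ 3"
    and a: "fiber D (m - 1) < fiber D 0"
  defines "L \<equiv> ln (real (fiber D 0) / real (fiber D (m - 1)))"
    and "\<kappa> \<equiv> 1 / ln (real m) - 1 / ln (real n)"
  shows "0 < fiber D (m - 1) \<and> (\<exists>C. \<exists>r0>0. \<forall>r. 0 < r \<longrightarrow> r < r0 \<longrightarrow>
    (\<forall>z'\<in>E. dist z z' < r \<longrightarrow>
      ln (measure \<mu> (ball z r \<inter> E) / measure \<mu> (ball z' (\<rho> * r) \<inter> E)) \<le> \<kappa> * L * ln (1 / r) + C) \<and>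
    (\<exists>z'\<in>E. ball z' (\<rho> * r) \<inter> E \<subseteq> ball z r \<inter> E \<and>
      \<kappa> * L * ln (1 / r) - C \<le> ln (measure \<mu> (ball z r \<inter> E) / measure \<mu> (ball z' (\<rho> * r) \<inter> E))))"
proof -
  let ?a = "real (fiber D 0)" and ?b = "real (fiber D (m - 1))" and ?N = "real (card D)"
  have N: "?N > 0" using card_D_pos by simp
  have zE: "z \<in> E" using z by (auto simp: vertical_overlap_def)
  obtain d d' q where d: "is_coding n m D d z" "is_coding n m D d' z"
    and q: "row_num (map d' [0..<q]) < row_num (map d [0..<q])"
    using vertical_overlapE[OF z] .
  have D: "\<forall>j. d j \<in> D" "\<forall>j. d' j \<in> D" using d by (simp_all add: is_coding_iff)
  have c: "z \<in> word_map (map d [0..<t]) ` E" "z \<in> word_map (map d' [0..<t]) ` E" for t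
    using d by (simp_all add: is_coding_iff)
  note tails = overlap_tails[OF d q]
  have "1 \<le> fiber D (m - 1)" using fiber_ge_1[of "d' q"] D tails(4)[of q] by simp
  then have b: "1 \<le> ?b" and ab: "?b < ?a" using a by auto
  have a1: "1 \<le> ?a" using b ab by linarith
  have L: "L > 0" unfolding L_def using b ab by (intro ln_gt_zero) (simp add: field_simps)
  obtain e where e: "e \<in> E" "snd e = 0" using E_bottom a by force
  let ?K = "real n + real m"
  have K: "0 < ?K" using nm by simp
  obtain C where C: "C > 0" and cmp: "\<forall>z r k t w. 0 < r \<longrightarrow> k \<le> t \<longrightarrow> 1 / real n ^ k \<le> ?K * r \<longrightarrow>
    1 / real m ^ t \<le> ?K * r \<longrightarrow> w \<in> words t \<longrightarrow> z \<in> word_map w ` E \<longrightarrow>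
    real (row_weight (drop k (map snd w))) / ?N ^ t \<le> C * measure \<mu> (ball z (\<rho> * r) \<inter> E)"
    using measure_ball_compare[OF rho(1) K] by meson
  \<comment> \<open>\<open>L\<close> pays for rounding \<open>t - k\<close>. In \<open>6 * C\<close>
    the 6 is 3 columns times 2 rows; in \<open>3 * C\<close> the small ball meets a single
    row.\<close>
  define C' where "C' = L + \<bar>ln (6 * C)\<bar> + \<bar>ln (3 * C)\<bar>"
  have lnm: "ln (real m) > 0" "ln (real n) > 0" using nm by auto
  have "27 \<le> real n ^ 3"
    using power_mono[of 3 "real n" 3] nm by simp
  then have "1 / real n ^ 3 \<le> 1 / 27" using nm by (intro divide_left_mono) auto
  then have rho2: "\<rho> < 1 / 2" using rho by linarith
  have cancel: "6 * (x / w) / ((y / w) / c) = (6 * c) * (x / y)" "(1 / (3 * c)) * (x / y) = ((x / w) / c) / (3 * (y / w))"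
    if "0 < y" "0 < w" "0 < c" for x y w c :: real
    using that by (simp_all add: field_simps)
  have main: "(\<forall>z'\<in>E. dist z z' < r \<longrightarrow>
      ln (measure \<mu> (ball z r \<inter> E) / measure \<mu> (ball z' (\<rho> * r) \<inter> E)) \<le> \<kappa> * L * ln (1 / r) + C') \<and>
    (\<exists>z'\<in>E. ball z' (\<rho> * r) \<inter> E \<subseteq> ball z r \<inter> E \<and>
      \<kappa> * L * ln (1 / r) - C' \<le> ln (measure \<mu> (ball z r \<inter> E) / measure \<mu> (ball z' (\<rho> * r) \<inter> E)))"
    \<comment> \<open>This bound on \<open>r\<close> gives \<open>q \<le> k\<close>, so the digits
      from \<open>k\<close> on lie in the constant tails of both codings.\<close>
    if r: "0 < r" "r < 1 / real n ^ q" for r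
  proof -
    have "1 / real n ^ q \<le> 1" using nm by simp
    then have r1: "r \<le> 1" using r by linarith
    obtain k where k: "r \<le> 1 / real n ^ k" "1 / real n ^ Suc k < r"
      and kln: "real k * ln (real n) \<le> ln (1 / r)" "ln (1 / r) \<le> (real k + 1) * ln (real n)"
      using ex_scale[OF nm(5) r(1) r1] by blast
    obtain t where t: "r \<le> 1 / real m ^ t" "1 / real m ^ Suc t < r"
      and tln: "real t * ln (real m) \<le> ln (1 / r)" "ln (1 / r) \<le> (real t + 1) * ln (real m)"
      using ex_scale[OF nm(2) r(1) r1] by blast
    have "1 / real n ^ Suc k < 1 / real n ^ q" using k r by linarith
    then have "real n ^ q < real n ^ Suc k" using nm by (simp add: divide_simps)
    then have qk: "q \<le> k" using nm by (subst (asm) power_strict_increasing_iff) auto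
    have "1 / real n ^ k \<le> 1 / real m ^ k" using nm by (intro divide_left_mono power_mono) auto
    then have "1 / real m ^ Suc t < 1 / real m ^ k" using k t by linarith
    then have "real m ^ k < real m ^ Suc t" using nm by (simp add: divide_simps)
    then have kt: "k \<le> t" using nm by (subst (asm) power_strict_increasing_iff) auto
    have qt: "q \<le> t" using qk kt by simp
    have nk: "1 / real n ^ k \<le> ?K * r"
    proof -
      have "1 / real n ^ k = real n * (1 / real n ^ Suc k)" using nm by simp
      also have "\<dots> \<le> real n * r" using k by (intro mult_left_mono) auto
      also have "\<dots> \<le> ?K * r" using r by (simp add: algebra_simps)
      finally show ?thesis .
    qed
    have mt: "1 / real m ^ t \<le> ?K * r"
    proof -
      have "1 / real m ^ t = real m * (1 / real m ^ Suc t)" using nm by simp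
      also have "\<dots> \<le> real m * r" using t by (intro mult_left_mono) auto
      also have "\<dots> \<le> ?K * r" using r by (simp add: algebra_simps)
      finally show ?thesis .
    qed
    define p where "p = t - k"
    have tk: "real t - real k = real p" using kt by (simp add: p_def)
    \<comment> \<open>Each level falls short of its logarithmic value by at most 1, so their
      difference is off by at most 1 either way.\<close>
    have p1: "real p * L \<le> \<kappa> * L * ln (1 / r) + L" and p2: "\<kappa> * L * ln (1 / r) - L \<le> real p * L"
    proof -
      have "real t \<le> ln (1 / r) / ln (real m)" "ln (1 / r) / ln (real m) \<le> real t + 1"
        "real k \<le> ln (1 / r) / ln (real n)" "ln (1 / r) / ln (real n) \<le> real k + 1"
        using lnm kln tln by (simp_all only: pos_le_divide_eq pos_divide_le_eq)
      then have "real p \<le> \<kappa> * ln (1 / r) + 1" "\<kappa> * ln (1 / r) - 1 \<le> real p"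
        unfolding tk[symmetric] \<kappa>_def left_diff_distrib times_divide_eq_left mult_1 by linarith+
      then have "real p * L \<le> (\<kappa> * ln (1 / r) + 1) * L" "(\<kappa> * ln (1 / r) - 1) * L \<le> real p * L"
        using L by (auto intro: mult_right_mono)
      then show "real p * L \<le> \<kappa> * L * ln (1 / r) + L" "\<kappa> * L * ln (1 / r) - L \<le> real p * L"
        by (simp_all add: algebra_simps)
    qed
    define V0 V1 where "V0 = map snd (map d [0..<t])" and "V1 = map snd (map d' [0..<t])"
    have wt0: "real (row_weight (drop k V0)) = ?a ^ p"
    proof -
      have "drop k V0 = replicate p 0"
        by (rule nth_equalityI) (use tails(3) qk in \<open>auto simp: V0_def p_def\<close>)
      then show ?thesis by (simp add: row_weight_replicate)
    qed
    have wt1: "real (row_weight (drop k V1)) = ?b ^ p"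
    proof -
      have "drop k V1 = replicate p (m - 1)"
        by (rule nth_equalityI) (use tails(4) qk in \<open>auto simp: V1_def p_def\<close>)
      then show ?thesis by (simp add: row_weight_replicate)
    qed
    have bap: "?b ^ p \<le> ?a ^ p" using ab b by (intro power_mono) auto
    have pos: "0 < ?a ^ p" "0 < ?b ^ p" "0 < ?N ^ t" using a1 b N by auto
    have Lp: "ln (?a ^ p / ?b ^ p) = real p * L"
      using a1 b unfolding L_def by (simp add: power_divide[symmetric] ln_realpow)
    \<comment> \<open>Here \<open>z\<close> lies on the edge between two adjacent rows and
      \<open>r\<close> is at most a row height, so no third row is reached.\<close>
    have hit: "map snd w = V0 \<or> map snd w = V1" if w: "w \<in> hits t (ball z r)" for w
    proof -
      have "r * real m ^ t \<le> 1" using t(1) nm by (simp add: pos_le_divide_eq)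
      then have "real m ^ t * r \<le> 1" by (simp add: mult.commute)
      then have "real (row_num w) < real (row_num (map d [0..<t])) + 1"
        "real (row_num (map d [0..<t])) < real (row_num w) + 2"
        using hits_row_num[OF w] unfolding tails(1)[OF qt] by linarith+
      then have "row_num w = row_num (map d [0..<t]) \<or> row_num w = row_num (map d' [0..<t])"
        using tails(2)[OF qt] by linarith
      moreover have "w \<in> words t" using w by (simp add: hits_def)
      ultimately show ?thesis using row_num_eqD map_words D unfolding V0_def V1_def by blast
    qed
    have up: "measure \<mu> (ball z r \<inter> E) \<le> 6 * (?a ^ p / ?N ^ t)"
    proof -
      have "measure \<mu> (ball z r \<inter> E) \<le> 3 * (\<Sum>V\<in>{V0, V1}. real (row_weight (drop k V))) / ?N ^ t"
        using hit by (intro measure_ball_le[OF kt _ k(1)]) auto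
      also have "(\<Sum>V\<in>{V0, V1}. real (row_weight (drop k V))) \<le> 2 * ?a ^ p"
        using wt0 wt1 bap pos by (cases "V0 = V1") auto
      then have "3 * (\<Sum>V\<in>{V0, V1}. real (row_weight (drop k V))) / ?N ^ t \<le> 3 * (2 * ?a ^ p) / ?N ^ t"
        using pos by (intro divide_right_mono mult_left_mono) auto
      finally show ?thesis by simp
    qed
    have upper: "ln (measure \<mu> (ball z r \<inter> E) / measure \<mu> (ball z' (\<rho> * r) \<inter> E)) \<le> \<kappa> * L * ln (1 / r) + C'"
      if z': "z' \<in> E" "dist z z' < r" for z'
    proof -
      let ?M = "measure \<mu> (ball z r \<inter> E)" and ?M' = "measure \<mu> (ball z' (\<rho> * r) \<inter> E)"
      have M: "0 < ?M" "0 < ?M'" using measure_ball_pos zE z' r rho by auto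
      obtain w where w: "w \<in> words t" "z' \<in> word_map w ` E" using E_word[OF z'(1)] by blast
      then have "w \<in> hits t (ball z r)" using z'(2) by (auto simp: hits_def)
      then have "?b ^ p \<le> real (row_weight (drop k (map snd w)))" using hit wt0 wt1 bap by fastforce
      then have "?b ^ p / ?N ^ t \<le> real (row_weight (drop k (map snd w))) / ?N ^ t"
        using pos by (intro divide_right_mono) auto
      also have "\<dots> \<le> C * ?M'" using cmp[rule_format, OF r(1) kt nk mt w] .
      finally have low: "?b ^ p / ?N ^ t \<le> C * ?M'" .
      have "?M / ?M' \<le> 6 * (?a ^ p / ?N ^ t) / ((?b ^ p / ?N ^ t) / C)"
      proof (rule frac_le)
        show "(?b ^ p / ?N ^ t) / C \<le> ?M'" using low C by (simp only: pos_divide_le_eq mult.commute[of _ C])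
        show "0 < (?b ^ p / ?N ^ t) / C" using pos C by (intro divide_pos_pos)
        show "0 \<le> 6 * (?a ^ p / ?N ^ t)" using pos by simp
      qed (rule up)
      also have "\<dots> = (6 * C) * (?a ^ p / ?b ^ p)" by (rule cancel(1)) (use pos C in auto)
      finally have "ln (?M / ?M') \<le> ln ((6 * C) * (?a ^ p / ?b ^ p))"
        using M by (intro ln_mono) auto
      also have "\<dots> = ln (6 * C) + ln (?a ^ p / ?b ^ p)"
        using C pos by (intro ln_mult_pos) auto
      also have "\<dots> \<le> \<kappa> * L * ln (1 / r) + C'" unfolding Lp C'_def using p1 by linarith
      finally show ?thesis .
    qed
    txt \<open>The point lies below the horizontal line through \<open>z\<close> by exactly \<open>1 / m ^ (t + 3)\<close>. This is between \<open>r / m ^ 3\<close>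
      and \<open>r / m ^ 2\<close>, so \<open>\<rho> < 1 / n ^ 3\<close> keeps the small ball both below the line and inside the
      large ball.\<close>
    define z' where "z' = word_map (map d' [0..<t + 3]) e"
    have z'E: "z' \<in> E" unfolding z'_def using word_map_E_subset[OF map_words[OF D(2)]] e(1) by blast
    have m3: "real m ^ (t + 3) > 0" using nm by simp
    have "dist z z' \<le> 2 / real m ^ (t + 3)"
      by (rule word_map_unit_diam(3)[of _ "map d' [0..<t + 3]"])
        (use c(2)[of "t + 3"] e(1) E_subset_unit in \<open>auto simp: z'_def\<close>)
    also have "\<dots> = (2 / real m ^ 2) * (1 / real m ^ Suc t)"
      by (simp add: power_add power2_eq_square power3_eq_cube)
    also have "\<dots> \<le> (1 / 2) * (1 / real m ^ Suc t)"
    proof (rule mult_right_mono)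
      have "2 ^ 2 \<le> real m ^ 2" using nm by (intro power_mono) auto
      then show "2 / real m ^ 2 \<le> 1 / 2" using nm by (simp add: divide_simps)
    qed simp
    also have "\<dots> \<le> r / 2" using t(2) by simp
    finally have dz: "dist z z' \<le> r / 2" .
    have rr: "\<rho> * r \<le> r / 2" using rho2 r by simp
    have sub: "ball z' (\<rho> * r) \<inter> E \<subseteq> ball z r \<inter> E"
    proof
      fix x assume x: "x \<in> ball z' (\<rho> * r) \<inter> E"
      then have "dist z x < r" using dist_triangle[of z x z'] dz rr by auto
      then show "x \<in> ball z r \<inter> E" using x by auto
    qed
    \<comment> \<open>As \<open>e\<close> has height 0, \<open>z'\<close> lies on the bottom edge of
      its row, whose top edge contains \<open>z\<close>.\<close>
    have "snd z' = real (row_num (map d' [0..<t + 3])) / real m ^ (t + 3)"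
      unfolding z'_def word_map_def row_num_def using e(2) by simp
    then have "real m ^ (t + 3) * snd z' = real (row_num (map d' [0..<t + 3]))" using m3 by simp
    moreover have "real m ^ (t + 3) * snd z = real (row_num (map d' [0..<t + 3])) + 1"
      using tails(1,2)[of "t + 3"] qt by simp
    ultimately have "real m ^ (t + 3) * (snd z - snd z') = 1" by (simp add: right_diff_distrib)
    then have gap: "snd z - snd z' = 1 / real m ^ (t + 3)" using m3 by (simp add: eq_divide_eq mult.commute)
    have "\<rho> * r < 1 / real m ^ (t + 3)"
    proof -
      have "\<rho> * r < (1 / real n ^ 3) * r" using rho r by (intro mult_strict_right_mono) auto
      also have "\<dots> \<le> (1 / real m ^ 3) * r" using nm r by (intro mult_right_mono divide_left_mono power_mono) auto
      also have "\<dots> \<le> (1 / real m ^ 3) * (1 / real m ^ t)" using t(1) by (intro mult_left_mono) auto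
      finally show ?thesis by (simp add: power_add mult.commute)
    qed
    then have below: "snd z' + \<rho> * r < snd z" using gap by linarith
    let ?M = "measure \<mu> (ball z r \<inter> E)" and ?M' = "measure \<mu> (ball z' (\<rho> * r) \<inter> E)"
    have M: "0 < ?M" "0 < ?M'" using measure_ball_pos zE z'E r rho by auto
    have "?M' \<le> 3 * (\<Sum>V\<in>{V1}. real (row_weight (drop k V))) / ?N ^ t"
    proof (rule measure_ball_le[OF kt])
      show "\<rho> * r \<le> 1 / real n ^ k" using rr r(1) k(1) by linarith
      fix w assume w: "w \<in> hits t (ball z' (\<rho> * r))"
      then obtain f where f: "f \<in> E" "word_map w f \<in> ball z' (\<rho> * r)" and ww: "w \<in> words t"
        by (auto simp: hits_def)
      have fE: "word_map w f \<in> E" using word_map_E_subset[OF ww] f(1) by blast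
      then have "word_map w f \<in> ball z r" using f(2) sub by blast
      then have "w \<in> hits t (ball z r)" using f(1) ww by (auto simp: hits_def)
      \<comment> \<open>Every point in the upper row has height at least \<open>snd z\<close>, while
        the small ball stays strictly below.\<close>
      moreover have "map snd w \<noteq> V0"
      proof
        assume "map snd w = V0"
        then have "real (row_num (map d [0..<t])) \<le> real m ^ t * snd (word_map w f)"
          using word_map_bounds(3)[OF f(1) ww] by (simp add: V0_def row_num_def)
        then have "real m ^ t * snd z \<le> real m ^ t * snd (word_map w f)" using tails(1)[OF qt] by simp
        then have "snd z \<le> snd (word_map w f)" using nm by simp
        moreover have "\<bar>snd z' - snd (word_map w f)\<bar> < \<rho> * r"
          using f(2) dist_snd_le[of z' "word_map w f"] by (simp add: dist_real_def)
        ultimately show False using below by linarith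
      qed
      ultimately show "map snd w \<in> {V1}" using hit by blast
    qed simp
    then have up': "?M' \<le> 3 * (?b ^ p / ?N ^ t)" using wt1 by simp
    \<comment> \<open>The cell of \<open>d\<close> contains \<open>z\<close>, so the upper, heavier
      row alone supplies the mass of the large ball.\<close>
    have "?a ^ p / ?N ^ t \<le> C * measure \<mu> (ball z (\<rho> * r) \<inter> E)"
      using cmp[rule_format, OF r(1) kt nk mt map_words[OF D(1)] c(1)] wt0 by (simp add: V0_def)
    also have "\<dots> \<le> C * ?M"
    proof (intro mult_left_mono finite_measure_mono)
      have "\<rho> * r \<le> r" using rr r by linarith
      then show "ball z (\<rho> * r) \<inter> E \<subseteq> ball z r \<inter> E" using subset_ball by blast
      show "ball z r \<inter> E \<in> events" unfolding sets_mu by (intro sets.Int E_sets) simp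
    qed (use C in simp)
    finally have low: "?a ^ p / ?N ^ t \<le> C * ?M" .
    have "(1 / (3 * C)) * (?a ^ p / ?b ^ p) = ((?a ^ p / ?N ^ t) / C) / (3 * (?b ^ p / ?N ^ t))"
      by (rule cancel(2)) (use pos C in auto)
    also have "\<dots> \<le> ?M / ?M'"
    proof (rule frac_le)
      show "(?a ^ p / ?N ^ t) / C \<le> ?M" using low C by (simp only: pos_divide_le_eq mult.commute[of _ C])
      show "0 \<le> ?M" by simp
    qed (rule M up')+
    finally have "ln ((1 / (3 * C)) * (?a ^ p / ?b ^ p)) \<le> ln (?M / ?M')"
      using C pos by (intro ln_mono) auto
    moreover have "ln ((1 / (3 * C)) * (?a ^ p / ?b ^ p)) = ln (1 / (3 * C)) + real p * L"
      unfolding Lp[symmetric] using C pos by (intro ln_mult_pos) auto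
    moreover have "ln (1 / (3 * C)) = - ln (3 * C)" using C by (simp add: ln_div)
    ultimately have "\<kappa> * L * ln (1 / r) - C' \<le> ln (?M / ?M')" unfolding C'_def using p2 by linarith
    then show ?thesis using upper z'E sub by blast
  qed
  have "0 < 1 / real n ^ q" using nm by simp
  with main b show ?thesis by (intro conjI exI[of _ C'] exI[of _ "1 / real n ^ q"]) auto
qed

end

section \<open>Gauge functions and the index\<close>

text \<open>Monotonicity of \<open>\<phi>\<close> controls the radii between consecutive powers: the
  quotient lies between \<open>k * ln b / \<phi> (1 / b ^ (k + 1))\<close> and
  \<open>(k + 1) * ln b / \<phi> (1 / b ^ k)\<close>. The index shift costs a multiple of
  \<open>1 / \<phi>\<close>, which tends to 0. Extended reals cover infinite \<open>s\<close> as
  well.\<close>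

lemma gauge_growth_continuous:
  assumes gauge: "gauge_function \<phi>" and b: "2 \<le> b"
    and lim: "(\<lambda>k::nat. ereal (real k / \<phi> (1 / real b ^ k))) \<longlonglongrightarrow> s" and s: "0 \<le> s"
  shows "((\<lambda>r. ereal (ln (1 / r) / \<phi> r)) \<longlongrightarrow> ereal (ln (real b)) * s) (at_right 0)"
proof -
  have pos: "\<phi> r > 0" if "0 < r" "r < 1" for r
    using gauge that by (auto simp: gauge_function_def)
  have anti: "\<phi> r' \<le> \<phi> r" if "0 < r" "r \<le> r'" "r' < 1" for r r'
  proof (cases "r = r'")
    case False
    then have "r < r'" using that by simp
    then have "\<phi> r' < \<phi> r"
      using gauge that unfolding gauge_function_def monotone_on_def by auto
    then show ?thesis by simp
  qed simp
  have b0: "0 < real b" "1 < real b" using b by auto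
  have lnb: "0 < ln (real b)" using b0 by simp
  define P where "P k = \<phi> (1 / real b ^ k)" for k
  have "\<forall>r\<in>{0<..1}. \<exists>k. r \<le> 1 / real b ^ k \<and> 1 / real b ^ Suc k < r \<and>
      real k * ln (real b) \<le> ln (1 / r) \<and> ln (1 / r) \<le> (real k + 1) * ln (real b)"
  proof
    fix r :: real assume "r \<in> {0<..1}"
    then show "\<exists>k. r \<le> 1 / real b ^ k \<and> 1 / real b ^ Suc k < r \<and>
      real k * ln (real b) \<le> ln (1 / r) \<and> ln (1 / r) \<le> (real k + 1) * ln (real b)"
      using ex_scale[OF b, of r] by (metis greaterThanAtMost_iff)
  qed
  from bchoice[OF this] obtain K where "\<forall>r\<in>{0<..1}. r \<le> 1 / real b ^ K r \<and> 1 / real b ^ Suc (K r) < r \<and>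
      real (K r) * ln (real b) \<le> ln (1 / r) \<and> ln (1 / r) \<le> (real (K r) + 1) * ln (real b)" ..
  then have K: "r \<le> 1 / real b ^ K r" "1 / real b ^ Suc (K r) < r"
      "real (K r) * ln (real b) \<le> ln (1 / r)" "ln (1 / r) \<le> (real (K r) + 1) * ln (real b)"
    if "0 < r" "r \<le> 1" for r
    using that greaterThanAtMost_iff by blast+
  have K_ge: "j \<le> K r" if "0 < r" "r < 1 / real b ^ j" for r j
  proof -
    have "1 / real b ^ j \<le> 1" using b0 by simp
    then have "1 / real b ^ Suc (K r) < 1 / real b ^ j" using K(2)[of r] that by linarith
    then have "real b ^ j < real b ^ Suc (K r)" using b0 by (simp add: divide_simps)
    then show ?thesis using b0 by (subst (asm) power_strict_increasing_iff) auto
  qed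
  have ev: "eventually (\<lambda>r. 0 < r \<and> r < 1 / real b ^ j) (at_right 0)" for j
    using b0 unfolding eventually_at_right_field by (intro exI[of _ "1 / real b ^ j"]) auto
  have Klim: "filterlim K at_top (at_right 0)"
    unfolding filterlim_at_top
  proof
    fix j show "eventually (\<lambda>r. j \<le> K r) (at_right 0)"
      using ev[of j] by eventually_elim (use K_ge in blast)
  qed
  have "filterlim (\<lambda>k. 1 / real b ^ k) (at_right 0) sequentially"
  proof (rule tendsto_imp_filterlim_at_right)
    have "(\<lambda>k. (1 / real b) ^ k) \<longlonglongrightarrow> 0" using b0 by (intro LIMSEQ_power_zero) auto
    then show "(\<lambda>k. 1 / real b ^ k) \<longlonglongrightarrow> 0" by (simp add: power_one_over)
  qed (use b0 in simp)
  then have "filterlim P at_top sequentially"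
    using gauge filterlim_compose unfolding P_def gauge_function_def by blast
  then have "(\<lambda>k. 1 / P k) \<longlonglongrightarrow> 0"
    using tendsto_inverse_0_at_top by (auto simp: inverse_eq_divide)
  then have inv: "(\<lambda>k. ereal (1 / P k)) \<longlonglongrightarrow> 0" "(\<lambda>k. ereal (- 1 / P k)) \<longlonglongrightarrow> 0"
    using tendsto_minus[of "\<lambda>k. 1 / P k" 0 sequentially] by (simp_all add: zero_ereal_def)
  have lim: "(\<lambda>k. ereal (real k / P k)) \<longlonglongrightarrow> s" using lim by (simp add: P_def)
  have "(\<lambda>k. ereal (ln b) * (ereal (real k / P k) + ereal (1 / P k))) \<longlonglongrightarrow> ereal (ln b) * (s + 0)"
    using s by (intro tendsto_cmult_ereal tendsto_add_ereal_general lim inv) auto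
  then have up: "(\<lambda>k. ereal ((real k + 1) * ln b / P k)) \<longlonglongrightarrow> ereal (ln b) * s"
    by (simp add: add_divide_distrib algebra_simps)
  \<comment> \<open>Writing \<open>k\<close> as \<open>Suc k - 1\<close> aligns the numerator with
    the argument of \<open>P\<close>, so the shifted hypothesis applies.\<close>
  have "(\<lambda>k. ereal (ln b) * (ereal (real (Suc k) / P (Suc k)) + ereal (- 1 / P (Suc k)))) \<longlonglongrightarrow> ereal (ln b) * (s + 0)"
    using s by (intro tendsto_cmult_ereal tendsto_add_ereal_general LIMSEQ_Suc[OF lim] LIMSEQ_Suc[OF inv(2)]) auto
  then have low: "(\<lambda>k. ereal (real k * ln b / P (Suc k))) \<longlonglongrightarrow> ereal (ln b) * s"
    by (simp add: add_divide_distrib diff_divide_distrib algebra_simps)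
  show ?thesis
  proof (rule tendsto_sandwich[OF _ _ filterlim_compose[OF low Klim] filterlim_compose[OF up Klim]])
    show "\<forall>\<^sub>F r in at_right 0. ereal (real (K r) * ln b / P (Suc (K r))) \<le> ereal (ln (1 / r) / \<phi> r)"
      using ev[of 1]
    proof eventually_elim
      case (elim r)
      moreover have "1 / real b ^ 1 \<le> 1" using b0 by simp
      ultimately have r: "0 < r" "r < 1" by linarith+
      have "\<phi> r \<le> P (Suc (K r))" unfolding P_def using K(2)[of r] r b0 by (intro anti) auto
      then have "real (K r) * ln b / P (Suc (K r)) \<le> ln (1 / r) / \<phi> r"
        using K(3)[of r] r lnb pos[OF r] by (intro frac_le) auto
      then show ?case by simp
    qed
    show "\<forall>\<^sub>F r in at_right 0. ereal (ln (1 / r) / \<phi> r) \<le> ereal ((real (K r) + 1) * ln b / P (K r))"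
      using ev[of 1]
    proof eventually_elim
      case (elim r)
      moreover have "1 / real b ^ 1 \<le> 1" using b0 by simp
      ultimately have r: "0 < r" "r < 1" by linarith+
      \<comment> \<open>The gauge is controlled only on the open unit interval, so
        \<open>1 / b ^ K r\<close> must be kept away from 1.\<close>
      have "1 \<le> K r" using K_ge[of r 1] elim by simp
      then have "1 / real b ^ K r < 1" using b0 by (simp add: one_less_power)
      then have "0 < P (K r)" "P (K r) \<le> \<phi> r" unfolding P_def using K(1)[of r] r b0 by (auto intro!: anti pos)
      then have "ln (1 / r) / \<phi> r \<le> (real (K r) + 1) * ln b / P (K r)"
        using K(4)[of r] r lnb by (intro frac_le) auto
      then show ?case by simp
    qed
  qed
qed

lemma gauge_const_tendsto_0:
  assumes "gauge_function \<phi>"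
  shows "((\<lambda>r. C / \<phi> r) \<longlongrightarrow> 0) (at_right 0)"
  using assms unfolding gauge_function_def by (intro real_tendsto_divide_at_top[OF tendsto_const]) auto

lemma gauge_eventually_pos:
  assumes "gauge_function \<phi>"
  shows "\<forall>\<^sub>F r in at_right 0. 0 < r \<and> 0 < \<phi> r"
  using assms unfolding eventually_at_right_field gauge_function_def by (intro exI[of _ 1]) auto

section \<open>Evaluation of the lower doubling index in the two cases\<close>

theorem theorem1p1:
  fixes n m :: nat and D :: "(nat \<times> nat) set"
    and E :: "(real \<times> real) set" and \<mu> :: "(real \<times> real) measure"
    and \<rho> \<sigma> :: real and \<phi> :: "real \<Rightarrow> real" and s :: ereal
  assumes digits: "bm_digits n m D"
    and carpet: "is_bm_carpet n m D E"
    and bernoulli: "is_uniform_bernoulli n m D E \<mu>"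
    and sigma: "\<sigma> = ln (real m) / ln (real n)"
    and nondoubling: "\<not> doubling \<mu>"
    and fibers: "fiber D 0 > fiber D (m - 1)"
    and rho: "0 < \<rho>" "\<rho> < 1 / real n ^ 3"
    and gauge: "gauge_function \<phi>"
    and s_nonneg: "0 \<le> s"
    and growth: "(\<lambda>k::nat. ereal (real k / \<phi> (1 / real n ^ k))) \<longlonglongrightarrow> s"
  shows "\<forall>z\<in>E. lower_doubling_index E \<phi> z \<mu> \<rho> =
     (if z \<in> vertical_overlap n m D E
      then s * ereal ((1 / \<sigma> - 1) * ln (real (fiber D 0) / real (fiber D (m - 1))))
      else 0)"
proof
  fix z assume z: "z \<in> E"
  interpret bm_carpet n m D E \<mu> by unfold_locales (fact digits carpet bernoulli)+
  define M where "M z r = measure \<mu> (ball z r \<inter> E)" for z r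
  define A where "A r = {z'\<in>E. ball z' (\<rho> * r) \<inter> E \<subseteq> ball z r \<inter> E}" for r
  define f where "f r = (SUP z'\<in>A r. ereal (ln (M z r / M z' (\<rho> * r)) / \<phi> r))" for r
  have index: "lower_doubling_index E \<phi> z \<mu> \<rho> = Liminf (at_right 0) f"
    unfolding lower_doubling_index_def f_def A_def M_def ..
  have A: "z' \<in> E \<and> dist z z' < r" if "z' \<in> A r" "0 < r" for z' r
  proof -
    have "z' \<in> ball z' (\<rho> * r) \<inter> E" using that rho(1) by (simp add: A_def)
    then have "z' \<in> ball z r \<inter> E" using that(1) unfolding A_def by blast
    then show ?thesis by simp
  qed
  have Mpos: "0 < M z' r" if "z' \<in> E" "0 < r" for z' r
    using measure_ball_pos that by (simp add: M_def)
  show "lower_doubling_index E \<phi> z \<mu> \<rho> =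
     (if z \<in> vertical_overlap n m D E
      then s * ereal ((1 / \<sigma> - 1) * ln (real (fiber D 0) / real (fiber D (m - 1))))
      else 0)"
  proof (cases "z \<in> vertical_overlap n m D E")
    case True
    let ?L = "ln (real (fiber D 0) / real (fiber D (m - 1)))"
    let ?\<kappa> = "1 / ln (real m) - 1 / ln (real n)"
    obtain C r0 where bpos: "0 < fiber D (m - 1)" and r0: "r0 > 0"
      and up: "\<And>r z'. 0 < r \<Longrightarrow> r < r0 \<Longrightarrow> z' \<in> E \<Longrightarrow> dist z z' < r \<Longrightarrow>
        ln (M z r / M z' (\<rho> * r)) \<le> ?\<kappa> * ?L * ln (1 / r) + C"
      and low: "\<And>r. 0 < r \<Longrightarrow> r < r0 \<Longrightarrow>
        \<exists>z'\<in>A r. ?\<kappa> * ?L * ln (1 / r) - C \<le> ln (M z r / M z' (\<rho> * r))"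
    proof -
      from ball_ratio_at_overlap[OF True rho fibers] obtain C r0 where
        *: "0 < fiber D (m - 1)" "r0 > 0" "\<forall>r. 0 < r \<longrightarrow> r < r0 \<longrightarrow>
        (\<forall>z'\<in>E. dist z z' < r \<longrightarrow> ln (M z r / M z' (\<rho> * r)) \<le> ?\<kappa> * ?L * ln (1 / r) + C) \<and>
        (\<exists>z'\<in>E. ball z' (\<rho> * r) \<inter> E \<subseteq> ball z r \<inter> E \<and>
          ?\<kappa> * ?L * ln (1 / r) - C \<le> ln (M z r / M z' (\<rho> * r)))"
        unfolding M_def by blast
      show thesis
      proof (rule that[OF *(1,2)])
        fix r :: real assume r: "0 < r" "r < r0"
        show "ln (M z r / M z' (\<rho> * r)) \<le> ?\<kappa> * ?L * ln (1 / r) + C" if "z' \<in> E" "dist z z' < r" for z'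
          using *(3) r that by blast
        show "\<exists>z'\<in>A r. ?\<kappa> * ?L * ln (1 / r) - C \<le> ln (M z r / M z' (\<rho> * r))"
          using *(3) r unfolding A_def by blast
      qed
    qed
    have lnm: "ln (real m) > 0" "ln (real n) > 0" using nm by auto
    \<comment> \<open>The change of units: levels of base \<open>n\<close> in the hypothesis,
      natural logarithms in the ball estimates, and
      \<open>?\<kappa> * ln n = 1 / \<sigma> - 1\<close>.\<close>
    have B: "ereal (?\<kappa> * ?L) * (ereal (ln (real n)) * s) = s * ereal ((1 / \<sigma> - 1) * ?L)"
    proof -
      have *: "(1 / x - 1 / y) * l * y = (1 / (x / y) - 1) * l" if "0 < x" "0 < y" for x y l :: real
        using that by (simp add: field_simps)
      have "ereal (?\<kappa> * ?L) * (ereal (ln (real n)) * s) = ereal (?\<kappa> * ?L * ln (real n)) * s"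
        by (simp only: mult.assoc[symmetric] times_ereal.simps(1))
      then show ?thesis unfolding *[OF lnm] sigma by (simp only: mult.commute)
    qed
    note base = gauge_growth_continuous[OF gauge nm(5) growth s_nonneg]
    have sandwich: "((\<lambda>r. ereal ((?\<kappa> * ?L * ln (1 / r) + c) / \<phi> r)) \<longlongrightarrow> s * ereal ((1 / \<sigma> - 1) * ?L)) (at_right 0)" for c
    proof -
      have "((\<lambda>r. ereal (?\<kappa> * ?L) * ereal (ln (1 / r) / \<phi> r) + ereal (c / \<phi> r)) \<longlongrightarrow>
          ereal (?\<kappa> * ?L) * (ereal (ln (real n)) * s) + ereal 0) (at_right 0)"
        by (intro tendsto_add_ereal_general tendsto_cmult_ereal base tendsto_ereal gauge_const_tendsto_0[OF gauge]) auto
      then show ?thesis unfolding B by (simp add: add_divide_distrib)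
    qed
    have ev: "\<forall>\<^sub>F r in at_right 0. 0 < r \<and> r < r0 \<and> 0 < \<phi> r"
    proof -
      have "\<forall>\<^sub>F r in at_right 0. r < r0"
        using r0 unfolding eventually_at_right_field by blast
      then show ?thesis using gauge_eventually_pos[OF gauge] by eventually_elim simp
    qed
    \<comment> \<open>The supremum has a genuine limit here, since both bounds hold at all small
      radii and the additive constants disappear against \<open>\<phi>\<close>.\<close>
    have "(f \<longlongrightarrow> s * ereal ((1 / \<sigma> - 1) * ?L)) (at_right 0)"
    proof (rule tendsto_sandwich[OF _ _ sandwich[of "- C"] sandwich[of C]])
      show "\<forall>\<^sub>F r in at_right 0. ereal ((?\<kappa> * ?L * ln (1 / r) + - C) / \<phi> r) \<le> f r"
        using ev
      proof eventually_elim
        case (elim r)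
        then obtain z' where z': "z' \<in> A r" "?\<kappa> * ?L * ln (1 / r) - C \<le> ln (M z r / M z' (\<rho> * r))"
          using low by blast
        then have "(?\<kappa> * ?L * ln (1 / r) + - C) / \<phi> r \<le> ln (M z r / M z' (\<rho> * r)) / \<phi> r"
          using elim by (intro divide_right_mono) auto
        then show ?case unfolding f_def using z'(1) by (intro SUP_upper2[of z']) auto
      qed
      show "\<forall>\<^sub>F r in at_right 0. f r \<le> ereal ((?\<kappa> * ?L * ln (1 / r) + C) / \<phi> r)"
        using ev
      proof eventually_elim
        case (elim r)
        show ?case unfolding f_def
        proof (rule SUP_least)
          fix z' assume "z' \<in> A r"
          then have "ln (M z r / M z' (\<rho> * r)) \<le> ?\<kappa> * ?L * ln (1 / r) + C"
            using A[of z' r] up elim by blast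
          then show "ereal (ln (M z r / M z' (\<rho> * r)) / \<phi> r) \<le> ereal ((?\<kappa> * ?L * ln (1 / r) + C) / \<phi> r)"
            using elim by (simp add: divide_right_mono)
        qed
      qed
    qed
    then have "Liminf (at_right 0) f = s * ereal ((1 / \<sigma> - 1) * ?L)"
      by (intro lim_imp_Liminf) simp
    then show ?thesis using True index by simp
  next
    case False
    obtain C where C: "C > 0" and bd: "\<forall>\<epsilon>>0. \<exists>r. 0 < r \<and> r < \<epsilon> \<and>
        (\<forall>z'\<in>E. dist z z' < r \<longrightarrow> M z r \<le> C * M z' (\<rho> * r))"
      using ball_ratio_bounded_off_overlap[OF z False rho(1)] unfolding M_def by blast
    have "1 / real n ^ 3 \<le> 1" using nm by simp
    then have rho1: "\<rho> < 1" using rho by linarith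
    \<comment> \<open>The choice \<open>z' = z\<close> is always admissible and gives a ratio of at
      least 1.\<close>
    have "\<forall>\<^sub>F r in at_right 0. 0 \<le> f r"
      using gauge_eventually_pos[OF gauge]
    proof eventually_elim
      case (elim r)
      then have "\<rho> * r \<le> r" using rho1 by simp
      then have sub: "ball z (\<rho> * r) \<inter> E \<subseteq> ball z r \<inter> E" using subset_ball by blast
      then have "M z (\<rho> * r) \<le> M z r" unfolding M_def
        by (intro finite_measure_mono) (auto intro!: sets.Int E_sets simp: sets_mu)
      then have "0 \<le> ln (M z r / M z (\<rho> * r)) / \<phi> r"
        using Mpos[OF z, of "\<rho> * r"] elim rho by (intro divide_nonneg_pos ln_ge_zero) auto
      then show ?case unfolding f_def using sub z by (intro SUP_upper2[of z]) (auto simp: A_def)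
    qed
    then have "0 \<le> Liminf (at_right 0) f" by (rule Liminf_bounded)
    moreover have "Liminf (at_right 0) f \<le> 0"
    \<comment> \<open>A positive lower limit would keep \<open>f\<close> above some
      \<open>y > 0\<close> at all small radii, but arbitrarily small good radii have
      \<open>f r \<le> ln C / \<phi> r\<close>, which tends to 0.\<close>
    proof (rule ccontr)
      assume "\<not> Liminf (at_right 0) f \<le> 0"
      then have "0 < Liminf (at_right 0) f" by simp
      then obtain y where y: "0 < ereal y" "ereal y < Liminf (at_right 0) f"
        using ereal_dense2 by blast
      have "\<forall>\<^sub>F r in at_right 0. ereal y < f r" using y(2) by (rule less_LiminfD)
      moreover have "\<forall>\<^sub>F r in at_right 0. ln C / \<phi> r < y"
        using order_tendstoD(2)[OF gauge_const_tendsto_0[OF gauge]] y(1) by simp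
      ultimately have "\<forall>\<^sub>F r in at_right 0. ereal y < f r \<and> ln C / \<phi> r < y \<and> 0 < r \<and> 0 < \<phi> r"
        using gauge_eventually_pos[OF gauge] by eventually_elim simp
      then obtain \<epsilon> where e: "\<epsilon> > 0" "\<And>r. 0 < r \<Longrightarrow> r < \<epsilon> \<Longrightarrow> ereal y < f r \<and> ln C / \<phi> r < y \<and> 0 < \<phi> r"
        unfolding eventually_at_right_field by auto
      obtain r where r: "0 < r" "r < \<epsilon>" "\<forall>z'\<in>E. dist z z' < r \<longrightarrow> M z r \<le> C * M z' (\<rho> * r)"
        using bd e(1) by blast
      have "f r \<le> ereal (ln C / \<phi> r)"
        unfolding f_def
      proof (rule SUP_least)
        fix z' assume "z' \<in> A r"
        then have z': "z' \<in> E" "dist z z' < r" using A r(1) by blast+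
        then have "M z r / M z' (\<rho> * r) \<le> C"
          using r Mpos[of z' "\<rho> * r"] rho by (simp add: pos_divide_le_eq)
        then have "ln (M z r / M z' (\<rho> * r)) \<le> ln C"
          using Mpos[OF z r(1)] Mpos[of z' "\<rho> * r"] z' rho r by (intro ln_mono) auto
        then show "ereal (ln (M z r / M z' (\<rho> * r)) / \<phi> r) \<le> ereal (ln C / \<phi> r)"
          using e(2)[OF r(1,2)] by (simp add: divide_right_mono)
      qed
      then have "ereal y < ereal (ln C / \<phi> r)" using e(2)[OF r(1,2)] by (meson less_le_trans)
      then show False using e(2)[OF r(1,2)] by simp
    qed
    ultimately show ?thesis using False index by simp
  qed
qed

end
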